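(* For both types of exploration (non-backtracking and backtracking), let $(\psi_n)$ be the mixing time scale of the random walks $(X_n)$. Suppose that $((d_i^{(G_n)})^2)_{i\in[n],\,n\ge3}$, respectively $((d_i^{(G_n)})^2)_{i\in[n],\,n\ge2}$, is uniformly bounded for non-backtracking, respectively backtracking, exploration. If $G_n$ converges locally in probability to $(G_\infty,\phi)$ as $n\to\infty$, with a deterministic law $\bar\Lambda$, then for any sequence $k_n$ such that $\lim_{n\to\infty}k_n/\psi_n=\infty$, $\mu_n^{(k_n)}$ converges weakly to $\mu$ in probability as $n\to\infty$, where $\mu$ is the law of $$\Delta_\phi=\frac{m^{(2)}}{m^{(1)}}-d_\phi,\qquad m^{(1)}=\mathbb E_{\bar\Lambda}[d_\phi],\quad m^{(2)}=\mathbb E_{\bar\Lambda}[d_\phi^2],$$ with $d_\phi$ the degree of the root $\phi$ in $G_\infty$.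
   Context: Graphs are undirected, simple or multi-graphs; $A^{(G)}_{i,j}$ is the number of edges connecting $i,j$ and $d_i^{(G)}$ the degree of $i$ in $G$. $G_n$ is a random graph with vertex set $[n]=\{1,\dots,n\}$ on a probability space $(\Omega_n,\mathcal F_n,\mathbb P_n)$. - Non-backtracking exploration: $G_n$ is simple, $n\ge3$, with minimum degree at least $2$. The walk $X_n$ starts at a uniform vertex, first moves to a uniform neighbour, and subsequently moves to a uniformly chosen neighbour different from the vertex visited immediately before. Its $k$-step probabilities are $P_n^{(k)}(i,j)=\sum \big(d_{i}^{(G_n)}\prod_{l=1}^{k-1}(d_{i_l}^{(G_n)}-1)\big)^{-1}$, the sum over all $(i_0,\dots,i_k)\in[n]^{k+1}$ with $i_0=i$, $i_k=j$, $\{i_l,i_{l+1}\}\in E(G_n)$ for $0\le l\le k-1$, and $i_{l-1}\ne i_{l+1}$ for $1\le l\le k-1$. - Backtracking exploration: $G_n$ is without self-loops and isolated vertices, $n\ge2$; $X_n$ is the Markov chain with uniform initial law and transition matrix $P_n(i,j)=A^{(G_n)}_{i,j}/d_i^{(G_n)}$, and $P_n^{(k)}=P_n^k$ is the $k$-th matrix power. The $k$-level friendship bias is $\Delta_{i,n}^{(k)}=\sum_{j\in[n]}P_n^{(k)}(i,j)d_j^{(G_n)}-d_i^{(G_n)}$, and $\mu_n^{(k)}=\frac1n\sum_{i\in[n]}\delta_{\Delta_{i,n}^{(k)}}$ (a random measure). Mixing time scale. $\mathcal D_n(k)=\max_{i\in[n]}\|P_n^{(k)}(i,\cdot)-\pi_n\|_{TV}$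 is the worst-case total variation distance at time $k$ to the stationary distribution $\pi_n(j)=d_j^{(G_n)}/\sum_{l\in[n]}d_l^{(G_n)}$. A diverging sequence $(\psi_n)$ is the mixing time scale if for any sequence $(k_n)$ in $\mathbb N_0$: (1) $\lim_n k_n/\psi_n=0$ implies $\mathcal D_n(k_n)\to1$ in probability; (2) $\lim_n k_n/\psi_n=\infty$ implies $\mathcal D_n(k_n)\to0$ in probability. $(G_\infty,\phi)$ is an almost surely locally finite rooted random tree with law $\bar\Lambda$: for non-backtracking exploration it is infinite with every vertex having at least one offspring; for backtracking exploration it is non-trivial (more than one vertex). "Deterministic law" means $\bar\Lambda$ is a fixed (non-random) probability measure; $\mathbb E_{\bar\Lambda}$ is its expectation. Local convergence in probability. For a rooted graph $(H,o)$, $B_r^{(H)}(o)$ is the rooted subgraph with root $o$ whose vertices are those at graph distance $\le r$ from $o$ and whose edges are all edges of $H$ between such vertices. $\mathscr G$ is the set of connected locally finite rooted graphs, up to rooted isomorphism, with metric $\mathrm d_{\mathscr G}((H_1,o_1),(H_2,o_2))=\big(1+\sup\{r\ge0: B_r^{(H_1)}(o_1)\simeq B_r^{(H_2)}(o_2)\}\big)^{-1}$. $\mathscr C(G_n,i)$ is the connected component of $i$ in $G_n$, rooted at $i$. $G_n$ converges locally in probability to $(G_\infty,\phi)$ if $\frac1n\sum_{i\in[n]}h(\mathscr C(G_n,i))\to\mathbb E_{\bar\Lambda}[h((G_\infty,\phi))]$ in probability for every bounded continuous $h:\mathscr G\to\mathbb R$. Weak convergence in probability of random measures $\nu_n$ to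 $\nu$ means $\int f\,d\nu_n\to\int f\,d\nu$ in probability for every bounded continuous $f:\mathbb R\to\mathbb R$. *)

theory Defs
  imports "HOL-Probability.Probability"
    "HOL-Library.Extended_Nat"
    "HOL-Library.Diagonal_Subsequence"
begin

section \<open>Multigraphs\<close>

text \<open>
  An undirected multigraph is given by its vertex set and by the numbers \<open>mult G u v\<close> of edges
  joining \<open>u\<close> and \<open>v\<close> (\<open>mult G u u\<close> is the number of self-loops at \<open>u\<close>).  Vertices are natural
  numbers; as connected locally finite graphs are countable, every isomorphism class of such
  graphs has a representative of this kind.
\<close>

record mgraph =
  verts :: "nat set"
  mult :: "nat \<Rightarrow> nat \<Rightarrow> nat"

definition multigraph :: "mgraph \<Rightarrow> bool" where
  "multigraph G \<longleftrightarrow>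
     (\<forall>u v. mult G u v = mult G v u) \<and>
     (\<forall>u v. 0 < mult G u v \<longrightarrow> u \<in> verts G \<and> v \<in> verts G)"

definition adj :: "mgraph \<Rightarrow> (nat \<times> nat) set" where
  "adj G = {(u, v). 0 < mult G u v}"

definition locally_finite :: "mgraph \<Rightarrow> bool" where
  "locally_finite G \<longleftrightarrow> (\<forall>u\<in>verts G. finite (adj G `` {u}))"

definition loopless :: "mgraph \<Rightarrow> bool" where
  "loopless G \<longleftrightarrow> (\<forall>u. mult G u u = 0)"

definition simple_graph :: "mgraph \<Rightarrow> bool" where
  "simple_graph G \<longleftrightarrow> loopless G \<and> (\<forall>u v. mult G u v \<le> 1)"

definition connected_graph :: "mgraph \<Rightarrow> bool" where
  "connected_graph G \<longleftrightarrow> verts G \<noteq> {} \<and> (\<forall>u\<in>verts G. \<forall>v\<in>verts G. (u, v) \<in> (adj G)\<^sup>*)"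

text \<open>A self-loop contributes two to the degree.\<close>

definition degree :: "mgraph \<Rightarrow> nat \<Rightarrow> nat" where
  "degree G u = (\<Sum>v\<in>adj G `` {u}. mult G u v) + mult G u u"

text \<open>The graph distance is \<open>\<infinity>\<close> between different components.\<close>

definition gdist :: "mgraph \<Rightarrow> nat \<Rightarrow> nat \<Rightarrow> enat" where
  "gdist G u v = (INF k\<in>{k. (u, v) \<in> adj G ^^ k}. enat k)"

definition induced :: "mgraph \<Rightarrow> nat set \<Rightarrow> mgraph" where
  "induced G S = \<lparr>verts = verts G \<inter> S, mult = (\<lambda>u v. if u \<in> S \<and> v \<in> S then mult G u v else 0)\<rparr>"

definition has_cycle :: "mgraph \<Rightarrow> bool" where
  "has_cycle G \<longleftrightarrow>
     (\<exists>c. 3 \<le> length c \<and> distinct c \<and>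
        (\<forall>i<length c. (c ! i, c ! (Suc i mod length c)) \<in> adj G))"

definition tree :: "mgraph \<Rightarrow> bool" where
  "tree G \<longleftrightarrow> simple_graph G \<and> connected_graph G \<and> \<not> has_cycle G"


section \<open>Rooted graphs and the local metric\<close>

type_synonym rooted = "mgraph \<times> nat"

definition rooted_graph :: "rooted \<Rightarrow> bool" where
  "rooted_graph x \<longleftrightarrow>
     multigraph (fst x) \<and> locally_finite (fst x) \<and> connected_graph (fst x) \<and> snd x \<in> verts (fst x)"

definition is_rooted_iso :: "(nat \<Rightarrow> nat) \<Rightarrow> rooted \<Rightarrow> rooted \<Rightarrow> bool" where
  "is_rooted_iso f x y \<longleftrightarrow>
     bij_betw f (verts (fst x)) (verts (fst y)) \<and> f (snd x) = snd y \<and>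
     (\<forall>u\<in>verts (fst x). \<forall>v\<in>verts (fst x). mult (fst y) (f u) (f v) = mult (fst x) u v)"

definition rooted_iso :: "rooted \<Rightarrow> rooted \<Rightarrow> bool" where
  "rooted_iso x y \<longleftrightarrow> (\<exists>f. is_rooted_iso f x y)"

definition rooted_ball :: "nat \<Rightarrow> rooted \<Rightarrow> rooted" where
  "rooted_ball r x = (induced (fst x) {v. gdist (fst x) (snd x) v \<le> enat r}, snd x)"

definition offspring :: "rooted \<Rightarrow> nat \<Rightarrow> nat set" where
  "offspring x v =
     {w. (v, w) \<in> adj (fst x) \<and> gdist (fst x) (snd x) w = gdist (fst x) (snd x) v + 1}"

text \<open>
  In \<^typ>\<open>ennreal\<close> the supremum of the empty set is \<open>0\<close> and \<open>inverse \<infinity> = 0\<close>.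
\<close>

definition rooted_dist :: "rooted \<Rightarrow> rooted \<Rightarrow> real" where
  "rooted_dist x y =
     enn2real (inverse (1 + (SUP r\<in>{r. rooted_iso (rooted_ball r x) (rooted_ball r y)}. of_nat r)))"


subsection \<open>Invariance under isomorphism\<close>

lemma gdist_le_iff: "gdist G u v \<le> enat r \<longleftrightarrow> (\<exists>k\<le>r. (u, v) \<in> adj G ^^ k)"
proof
  assume le: "gdist G u v \<le> enat r"
  have ne: "enat ` {k. (u, v) \<in> adj G ^^ k} \<noteq> {}"
  proof
    assume "enat ` {k. (u, v) \<in> adj G ^^ k} = {}"
    hence "gdist G u v = \<infinity>" unfolding gdist_def by (simp add: top_enat_def)
    thus False using le by simp
  qed
  have "gdist G u v \<in> enat ` {k. (u, v) \<in> adj G ^^ k}"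
    unfolding gdist_def using wellorder_InfI[of _ "enat ` {k. (u, v) \<in> adj G ^^ k}"] ne by blast
  thus "\<exists>k\<le>r. (u, v) \<in> adj G ^^ k" using le by auto
next
  assume "\<exists>k\<le>r. (u, v) \<in> adj G ^^ k"
  then obtain k where k: "k \<le> r" "(u, v) \<in> adj G ^^ k" by blast
  have "gdist G u v \<le> enat k" unfolding gdist_def using k(2) by (intro INF_lower) simp
  thus "gdist G u v \<le> enat r" using k(1) by (meson enat_ord_simps(1) order_trans)
qed

lemma is_rooted_iso_inv:
  assumes "is_rooted_iso f x y" "snd x \<in> verts (fst x)"
  shows "is_rooted_iso (inv_into (verts (fst x)) f) y x"
proof -
  let ?V = "verts (fst x)"
  from assms have b: "bij_betw f ?V (verts (fst y))" and r: "f (snd x) = snd y"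
    and m: "\<And>u v. u \<in> ?V \<Longrightarrow> v \<in> ?V \<Longrightarrow> mult (fst y) (f u) (f v) = mult (fst x) u v"
    by (auto simp: is_rooted_iso_def)
  have 1: "bij_betw (inv_into ?V f) (verts (fst y)) ?V" using b by (rule bij_betw_inv_into)
  have 2: "inv_into ?V f (snd y) = snd x"
    using b assms(2) r by (metis bij_betw_inv_into_left)
  have 3: "mult (fst x) (inv_into ?V f u) (inv_into ?V f v) = mult (fst y) u v"
    if "u \<in> verts (fst y)" "v \<in> verts (fst y)" for u v
    using m[of "inv_into ?V f u" "inv_into ?V f v"] that 1 b
    by (simp add: bij_betw_inv_into_right bij_betwE)
  show ?thesis using 1 2 3 by (simp add: is_rooted_iso_def)
qed

lemma is_rooted_iso_comp:
  assumes "is_rooted_iso f x y" "is_rooted_iso g y z"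
  shows "is_rooted_iso (g \<circ> f) x z"
  using assms unfolding is_rooted_iso_def
  by (auto intro: bij_betw_trans simp: bij_betwE)

lemma rooted_iso_refl: "rooted_iso x x"
  unfolding rooted_iso_def is_rooted_iso_def by (intro exI[of _ id]) auto

lemma rooted_iso_sym: "rooted_iso x y \<Longrightarrow> snd x \<in> verts (fst x) \<Longrightarrow> rooted_iso y x"
  unfolding rooted_iso_def using is_rooted_iso_inv by blast

lemma rooted_iso_trans: "rooted_iso x y \<Longrightarrow> rooted_iso y z \<Longrightarrow> rooted_iso x z"
  unfolding rooted_iso_def using is_rooted_iso_comp by blast

lemma rooted_graphD:
  assumes "rooted_graph x"
  shows "multigraph (fst x)" "locally_finite (fst x)" "connected_graph (fst x)"
    "snd x \<in> verts (fst x)"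
  using assms by (auto simp: rooted_graph_def)

lemma multigraph_adjD:
  "multigraph G \<Longrightarrow> (u, v) \<in> adj G \<Longrightarrow> u \<in> verts G"
  "multigraph G \<Longrightarrow> (u, v) \<in> adj G \<Longrightarrow> v \<in> verts G"
  by (auto simp: multigraph_def adj_def)

lemma is_rooted_iso_adj:
  assumes "is_rooted_iso f x y" "u \<in> verts (fst x)" "v \<in> verts (fst x)"
  shows "(f u, f v) \<in> adj (fst y) \<longleftrightarrow> (u, v) \<in> adj (fst x)"
  using assms by (auto simp: is_rooted_iso_def adj_def)

lemma relpow_verts:
  assumes "multigraph G" "(u, v) \<in> adj G ^^ k" "u \<in> verts G"
  shows "v \<in> verts G"
  using assms(2)
proof (cases k)
  case 0 thus ?thesis using assms by simp
next
  case (Suc n) thus ?thesis using assms multigraph_adjD by (auto elim!: relpow_Suc_E)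
qed

lemma is_rooted_iso_relpow:
  assumes f: "is_rooted_iso f x y" and m: "multigraph (fst x)"
  shows "u \<in> verts (fst x) \<Longrightarrow> (u, v) \<in> adj (fst x) ^^ k \<Longrightarrow> (f u, f v) \<in> adj (fst y) ^^ k"
proof (induction k arbitrary: v)
  case 0 thus ?case by simp
next
  case (Suc k)
  then obtain w where w: "(u, w) \<in> adj (fst x) ^^ k" "(w, v) \<in> adj (fst x)"
    by (auto elim!: relpow_Suc_E)
  have "(f w, f v) \<in> adj (fst y)"
    using is_rooted_iso_adj[OF f] w(2) multigraph_adjD[OF m w(2)] by blast
  thus ?case using Suc.IH[OF Suc.prems(1) w(1)] by (meson relpow_Suc_I)
qed

lemma is_rooted_iso_relpow_iff:
  assumes f: "is_rooted_iso f x y" and x: "multigraph (fst x)" and y: "multigraph (fst y)"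
    and r: "snd x \<in> verts (fst x)" and u: "u \<in> verts (fst x)" and v: "v \<in> verts (fst x)"
  shows "(f u, f v) \<in> adj (fst y) ^^ k \<longleftrightarrow> (u, v) \<in> adj (fst x) ^^ k"
proof
  assume a: "(f u, f v) \<in> adj (fst y) ^^ k"
  have b: "bij_betw f (verts (fst x)) (verts (fst y))" using f by (simp add: is_rooted_iso_def)
  hence "f u \<in> verts (fst y)" using u by (simp add: bij_betwE)
  from is_rooted_iso_relpow[OF is_rooted_iso_inv[OF f r] y this a]
  show "(u, v) \<in> adj (fst x) ^^ k" using b u v by (simp add: bij_betw_inv_into_left)
qed (rule is_rooted_iso_relpow[OF f x u])

lemma is_rooted_iso_gdist:
  assumes "is_rooted_iso f x y" "multigraph (fst x)" "multigraph (fst y)"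
    "snd x \<in> verts (fst x)" "u \<in> verts (fst x)" "v \<in> verts (fst x)"
  shows "gdist (fst y) (f u) (f v) = gdist (fst x) u v"
  unfolding gdist_def using is_rooted_iso_relpow_iff[OF assms] by simp

lemma induced_simps [simp]:
  "verts (induced G S) = verts G \<inter> S"
  "mult (induced G S) u v = (if u \<in> S \<and> v \<in> S then mult G u v else 0)"
  by (simp_all add: induced_def)

lemma multigraph_induced: "multigraph G \<Longrightarrow> multigraph (induced G S)"
  by (auto simp: multigraph_def)

lemma adj_induced: "adj (induced G S) = adj G \<inter> S \<times> S"
  by (auto simp: adj_def)

lemma induced_induced: "induced (induced G S) T = induced G (S \<inter> T)"
  by (auto simp: induced_def fun_eq_iff)

lemma fst_rooted_ball:
  "fst (rooted_ball r x) = induced (fst x) {v. gdist (fst x) (snd x) v \<le> enat r}"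
  by (simp add: rooted_ball_def)

lemma snd_rooted_ball [simp]: "snd (rooted_ball r x) = snd x"
  by (simp add: rooted_ball_def)

lemma gdist_self [simp]: "gdist G u u = 0"
proof -
  have "gdist G u u \<le> enat 0" unfolding gdist_le_iff by auto
  thus ?thesis by (simp add: zero_enat_def[symmetric])
qed

lemma root_in_ball: "snd x \<in> verts (fst x) \<Longrightarrow> snd x \<in> verts (fst (rooted_ball r x))"
  by (simp add: fst_rooted_ball)

lemma multigraph_ball: "multigraph (fst x) \<Longrightarrow> multigraph (fst (rooted_ball r x))"
  by (simp add: fst_rooted_ball multigraph_induced)

lemma relpow_ball:
  "k \<le> r \<Longrightarrow> (snd x, v) \<in> adj (fst x) ^^ k \<Longrightarrow> (snd x, v) \<in> adj (fst (rooted_ball r x)) ^^ k"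
proof (induction k arbitrary: v)
  case 0 thus ?case by simp
next
  case (Suc k)
  then obtain w where w: "(snd x, w) \<in> adj (fst x) ^^ k" "(w, v) \<in> adj (fst x)"
    by (auto elim!: relpow_Suc_E)
  have "gdist (fst x) (snd x) w \<le> enat r" "gdist (fst x) (snd x) v \<le> enat r"
    unfolding gdist_le_iff using w(1) Suc.prems by (meson Suc_leD)+
  hence "(w, v) \<in> adj (fst (rooted_ball r x))"
    using w(2) by (simp add: fst_rooted_ball adj_induced)
  thus ?case using Suc.IH[OF _ w(1)] Suc.prems(1) by (meson Suc_leD relpow_Suc_I)
qed

lemma gdist_ball:
  assumes "s \<le> r"
  shows "gdist (fst (rooted_ball r x)) (snd x) v \<le> enat s \<longleftrightarrow> gdist (fst x) (snd x) v \<le> enat s"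
proof -
  have "adj (fst (rooted_ball r x)) ^^ k \<subseteq> adj (fst x) ^^ k" for k
  proof (induction k)
    case (Suc k)
    have "adj (fst (rooted_ball r x)) \<subseteq> adj (fst x)" by (auto simp: fst_rooted_ball adj_induced)
    thus ?case using Suc by (auto simp: relcomp_mono)
  qed simp
  thus ?thesis unfolding gdist_le_iff using relpow_ball[of _ r x v] assms
    by (meson order_trans subsetD)
qed

lemma ball_ball:
  assumes "s \<le> r"
  shows "rooted_ball s (rooted_ball r x) = rooted_ball s x"
proof -
  have "gdist (fst x) (snd x) v \<le> enat r" if "gdist (fst x) (snd x) v \<le> enat s" for v
    using that assms by (meson enat_ord_simps(1) order_trans)
  hence "{v. gdist (fst x) (snd x) v \<le> enat r} \<inter> {v. gdist (fst x) (snd x) v \<le> enat s} =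
        {v. gdist (fst x) (snd x) v \<le> enat s}" by blast
  thus ?thesis
    using gdist_ball[OF assms, of x]
    by (simp add: rooted_ball_def induced_induced)
qed

lemma is_rooted_iso_ball:
  assumes f: "is_rooted_iso f x y" and x: "multigraph (fst x)" and y: "multigraph (fst y)"
    and r: "snd x \<in> verts (fst x)"
  shows "is_rooted_iso f (rooted_ball s x) (rooted_ball s y)"
proof -
  have b: "bij_betw f (verts (fst x)) (verts (fst y))" and ro: "f (snd x) = snd y"
    and m: "\<And>u v. u \<in> verts (fst x) \<Longrightarrow> v \<in> verts (fst x) \<Longrightarrow>
      mult (fst y) (f u) (f v) = mult (fst x) u v"
    using f by (auto simp: is_rooted_iso_def)
  have d: "gdist (fst y) (snd y) (f v) = gdist (fst x) (snd x) v" if "v \<in> verts (fst x)" for v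
    using is_rooted_iso_gdist[OF f x y r r that] ro by simp
  have "bij_betw f (verts (fst (rooted_ball s x))) (verts (fst (rooted_ball s y)))"
    unfolding bij_betw_def
  proof
    show "inj_on f (verts (fst (rooted_ball s x)))"
      using b by (auto simp: fst_rooted_ball bij_betw_def intro: inj_on_subset)
    show "f ` verts (fst (rooted_ball s x)) = verts (fst (rooted_ball s y))"
    proof -
      have "f ` {v \<in> verts (fst x). gdist (fst x) (snd x) v \<le> enat s} =
          {w \<in> f ` verts (fst x). gdist (fst y) (snd y) w \<le> enat s}"
        using d by auto
      thus ?thesis using b by (simp add: fst_rooted_ball bij_betw_def Collect_conj_eq)
    qed
  qed
  thus ?thesis using ro m d by (auto simp: is_rooted_iso_def fst_rooted_ball)
qed

lemma rooted_iso_ball_mono: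
  assumes "rooted_iso (rooted_ball r x) (rooted_ball r y)" "s \<le> r"
    and "rooted_graph x" "rooted_graph y"
  shows "rooted_iso (rooted_ball s x) (rooted_ball s y)"
proof -
  obtain f where "is_rooted_iso f (rooted_ball r x) (rooted_ball r y)"
    using assms by (auto simp: rooted_iso_def)
  from is_rooted_iso_ball[OF this, of s] assms show ?thesis
    unfolding ball_ball[OF \<open>s \<le> r\<close>]
    by (auto simp: rooted_iso_def dest: rooted_graphD multigraph_ball root_in_ball)
qed

lemma rooted_iso_ball:
  assumes "rooted_iso x y" "rooted_graph x" "rooted_graph y"
  shows "rooted_iso (rooted_ball r x) (rooted_ball r y)"
  using assms is_rooted_iso_ball unfolding rooted_iso_def by (meson rooted_graphD)

lemma finite_ball:
  assumes "rooted_graph x"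
  shows "finite (verts (fst (rooted_ball r x)))"
proof -
  note x = rooted_graphD[OF assms]
  have fin: "finite {v. (snd x, v) \<in> adj (fst x) ^^ k}" for k
  proof (induction k)
    case 0 thus ?case by simp
  next
    case (Suc k)
    have "{v. (snd x, v) \<in> adj (fst x) ^^ Suc k} =
        (\<Union>w\<in>{w. (snd x, w) \<in> adj (fst x) ^^ k}. adj (fst x) `` {w})"
      by auto
    moreover have "finite (adj (fst x) `` {w})" if "(snd x, w) \<in> adj (fst x) ^^ k" for w
      using relpow_verts[OF x(1) that x(4)] x(2) by (simp add: locally_finite_def)
    ultimately show ?case using Suc by simp
  qed
  have "verts (fst (rooted_ball r x)) \<subseteq> (\<Union>k\<in>{..r}. {v. (snd x, v) \<in> adj (fst x) ^^ k})"
    by (auto simp: fst_rooted_ball gdist_le_iff)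
  thus ?thesis by (rule finite_subset) (simp add: fin)
qed

lemma verts_in_ball:
  assumes "rooted_graph x" "v \<in> verts (fst x)"
  obtains r where "\<And>R. r \<le> R \<Longrightarrow> v \<in> verts (fst (rooted_ball R x))"
proof -
  have "(snd x, v) \<in> (adj (fst x))\<^sup>*"
    using rooted_graphD[OF assms(1)] assms(2) by (simp add: connected_graph_def)
  then obtain k where "(snd x, v) \<in> adj (fst x) ^^ k" using rtrancl_imp_relpow by blast
  hence "v \<in> verts (fst (rooted_ball R x))" if "k \<le> R" for R
    using assms(2) that by (auto simp: fst_rooted_ball gdist_le_iff)
  thus ?thesis using that by blast
qed

lemma verts_ball_subset: "verts (fst (rooted_ball r x)) \<subseteq> verts (fst x)"
  by (auto simp: fst_rooted_ball)

lemma mult_ball: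
  "u \<in> verts (fst (rooted_ball r x)) \<Longrightarrow> v \<in> verts (fst (rooted_ball r x)) \<Longrightarrow>
    mult (fst (rooted_ball r x)) u v = mult (fst x) u v"
  by (auto simp: fst_rooted_ball)

text \<open>Locally finite connected graphs are isomorphic if all their balls are.\<close>

lemma rooted_iso_if_balls:
  assumes x: "rooted_graph x" and y: "rooted_graph y"
    and iso: "\<And>r. rooted_iso (rooted_ball r x) (rooted_ball r y)"
  shows "rooted_iso x y"
proof -
  define V where "V r = verts (fst (rooted_ball r x))" for r
  define W where "W r = verts (fst (rooted_ball r y))" for r
  note xg = rooted_graphD[OF x] and yg = rooted_graphD[OF y]
  obtain f where f: "\<And>r. is_rooted_iso (f r) (rooted_ball r x) (rooted_ball r y)"
    using iso unfolding rooted_iso_def by metis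
  have fs: "is_rooted_iso (f R) (rooted_ball s x) (rooted_ball s y)" if "s \<le> R" for s R
    using is_rooted_iso_ball[OF f[of R], of s] xg yg that
    by (simp add: ball_ball multigraph_ball root_in_ball)
  have bij: "bij_betw (f R) (V s) (W s)" if "s \<le> R" for s R
    using fs[OF that] by (simp add: is_rooted_iso_def V_def W_def)
  have mul: "mult (fst y) (f R u) (f R v) = mult (fst x) u v" if "u \<in> V R" "v \<in> V R" for R u v
  proof -
    have "f R u \<in> W R" "f R v \<in> W R" using bij[of R R] that by (auto simp: bij_betwE)
    hence "mult (fst (rooted_ball R y)) (f R u) (f R v) = mult (fst y) (f R u) (f R v)"
      unfolding W_def by (rule mult_ball)
    moreover have "mult (fst (rooted_ball R x)) u v = mult (fst x) u v"
      using that unfolding V_def by (rule mult_ball)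
    moreover have "mult (fst (rooted_ball R y)) (f R u) (f R v) = mult (fst (rooted_ball R x)) u v"
      using f[of R] that unfolding is_rooted_iso_def V_def by blast
    ultimately show ?thesis by simp
  qed
  have root: "f R (snd x) = snd y" for R using f[of R] by (simp add: is_rooted_iso_def)
  define P where "P v s \<longleftrightarrow> (v \<in> verts (fst x) \<longrightarrow>
      (\<exists>c N. \<forall>i\<ge>N. f (s i) v = c))" for v and s :: "nat \<Rightarrow> nat"
  interpret S: subseqs P
  proof
    fix v and s :: "nat \<Rightarrow> nat" assume s: "strict_mono s"
    show "\<exists>r'. strict_mono r' \<and> P v (s \<circ> r')"
    proof (cases "v \<in> verts (fst x)")
      case False thus ?thesis by (auto simp: P_def intro: exI[of _ id] strict_monoI)
    next
      case True
      obtain r where r: "\<And>R. r \<le> R \<Longrightarrow> v \<in> V R"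
        using verts_in_ball[OF x True] unfolding V_def by blast
      have "f (s i) v \<in> W r" if "i \<in> {r..}" for i
      proof -
        have "r \<le> s i" using that strict_mono_imp_increasing[OF s, of i] by simp
        thus ?thesis using bij[of r "s i"] r[of r] by (auto simp: bij_betwE)
      qed
      hence sub: "(\<lambda>i. f (s i) v) ` {r..} \<subseteq> W r" by blast
      have "finite (W r)" using finite_ball[OF y] by (simp add: W_def)
      hence "finite ((\<lambda>i. f (s i) v) ` {r..})" using sub by (rule rev_finite_subset)
      from pigeonhole_infinite[OF infinite_Ici this]
      obtain a where a: "infinite {i \<in> {r..}. f (s i) v = f (s a) v}" by blast
      let ?A = "{i \<in> {r..}. f (s i) v = f (s a) v}"
      have "f (s (enumerate ?A i)) v = f (s a) v" for i
        using enumerate_in_set[OF a, of i] by simp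
      moreover have "strict_mono (enumerate ?A)" by (rule strict_mono_enumerate[OF a])
      ultimately show ?thesis unfolding P_def
        by (intro exI[of _ "enumerate ?A"] conjI impI exI[of _ "f (s a) v"] exI[of _ 0])
          (simp_all only: o_def simp_thms)
    qed
  qed
  define d where "d = S.diagseq"
  have d_mono: "strict_mono d" unfolding d_def by (rule S.subseq_diagseq)
  have "\<exists>c N. \<forall>i\<ge>N. f (d i) v = c" if v: "v \<in> verts (fst x)" for v
  proof -
    have "P v (S.diagseq \<circ> ((+) (Suc v)))"
    proof (rule S.diagseq_holds)
      fix r s :: "nat \<Rightarrow> nat" and n
      assume r: "strict_mono r" and p: "P n s"
      show "P n (s \<circ> r)"
        unfolding P_def
      proof
        assume "n \<in> verts (fst x)"
        then obtain c N where c: "\<forall>i\<ge>N. f (s i) n = c" using p unfolding P_def by blast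
        have "N \<le> r i" if "N \<le> i" for i
          using that strict_mono_imp_increasing[OF r, of i] by simp
        hence "\<forall>i\<ge>N. f ((s \<circ> r) i) n = c" using c by simp
        thus "\<exists>c N. \<forall>i\<ge>N. f ((s \<circ> r) i) n = c" by blast
      qed
    qed
    then obtain c N where c: "\<And>i. N \<le> i \<Longrightarrow> f (d (Suc v + i)) v = c"
      using v unfolding P_def d_def by auto
    have "f (d i) v = c" if "Suc v + N \<le> i" for i
      using c[of "i - Suc v"] that by simp
    thus ?thesis by blast
  qed
  then obtain g N where g: "\<And>v i. v \<in> verts (fst x) \<Longrightarrow> N v \<le> i \<Longrightarrow> f (d i) v = g v"
    by metis
  have common: "\<exists>R\<ge>s. S0 \<subseteq> V R \<and> (\<forall>v\<in>S0. f R v = g v)"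
    if S0: "finite S0" "S0 \<subseteq> verts (fst x)" for S0 s
  proof -
    have "\<forall>v\<in>S0. \<exists>r. \<forall>R\<ge>r. v \<in> V R"
      using verts_in_ball[OF x] S0(2) unfolding V_def by (metis subsetD)
    then obtain r where r: "\<And>v R. v \<in> S0 \<Longrightarrow> r v \<le> R \<Longrightarrow> v \<in> V R" by metis
    define M where "M = s + (\<Sum>v\<in>S0. r v + N v)"
    have le: "r v + N v \<le> M" if "v \<in> S0" for v
      using member_le_sum[of v S0 "\<lambda>v. r v + N v"] S0(1) that by (simp add: M_def)
    have Md: "M \<le> d M" using strict_mono_imp_increasing[OF d_mono] .
    show ?thesis
    proof (intro exI[of _ "d M"] conjI ballI subsetI)
      show "s \<le> d M" using Md by (simp add: M_def)
      show "v \<in> V (d M)" if "v \<in> S0" for v using r[OF that, of "d M"] le[OF that] Md by simp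
      show "f (d M) v = g v" if "v \<in> S0" for v
        using g[of v M] le[OF that] S0(2) that by auto
    qed
  qed
  have "is_rooted_iso g x y"
    unfolding is_rooted_iso_def
  proof (intro conjI ballI)
    show "g (snd x) = snd y"
      using common[of "{snd x}" 0] xg(4) root by auto
    show "mult (fst y) (g u) (g v) = mult (fst x) u v"
      if "u \<in> verts (fst x)" "v \<in> verts (fst x)" for u v
      using common[of "{u, v}" 0] that mul by fastforce
    show "bij_betw g (verts (fst x)) (verts (fst y))"
      unfolding bij_betw_def
    proof (intro conjI inj_onI equalityI subsetI)
      fix u v assume uv: "u \<in> verts (fst x)" "v \<in> verts (fst x)" "g u = g v"
      then obtain R where "{u, v} \<subseteq> V R" "f R u = g u" "f R v = g v"
        using common[of "{u, v}" 0] by auto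
      thus "u = v" using bij[of R R] uv(3) by (metis bij_betw_def inj_onD insert_subset order_refl)
    next
      fix w assume "w \<in> g ` verts (fst x)"
      then obtain v where v: "v \<in> verts (fst x)" "w = g v" by blast
      then obtain R where "v \<in> V R" "f R v = w" using common[of "{v}" 0] by auto
      hence "w \<in> W R" using bij[of R R] by (auto simp: bij_betwE)
      thus "w \<in> verts (fst y)" using verts_ball_subset unfolding W_def by blast
    next
      fix w assume "w \<in> verts (fst y)"
      then obtain s where s: "w \<in> W s" using verts_in_ball[OF y] unfolding W_def by blast
      have "finite (V s)" "V s \<subseteq> verts (fst x)"
        using finite_ball[OF x] verts_ball_subset by (auto simp: V_def)
      then obtain R where R: "s \<le> R" "\<forall>v\<in>V s. f R v = g v" using common[of "V s" s] by blast
      then obtain v where "v \<in> V s" "f R v = w"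
        using bij[of s R] s by (metis bij_betw_def imageE)
      thus "w \<in> g ` verts (fst x)" using R(2) \<open>V s \<subseteq> _\<close> by force
    qed
  qed
  thus ?thesis by (auto simp: rooted_iso_def)
qed

lemma adj_image:
  assumes f: "is_rooted_iso f x y" and x: "multigraph (fst x)" and y: "multigraph (fst y)"
    and u: "u \<in> verts (fst x)"
  shows "adj (fst y) `` {f u} = f ` (adj (fst x) `` {u})"
proof -
  have b: "f ` verts (fst x) = verts (fst y)" using f by (auto simp: is_rooted_iso_def bij_betw_def)
  show ?thesis
  proof (intro equalityI subsetI)
    fix w assume w: "w \<in> adj (fst y) `` {f u}"
    hence "w \<in> verts (fst y)" using multigraph_adjD[OF y] by blast
    then obtain v where "v \<in> verts (fst x)" "w = f v" using b by blast
    thus "w \<in> f ` (adj (fst x) `` {u})" using w is_rooted_iso_adj[OF f u] by auto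
  next
    fix w assume "w \<in> f ` (adj (fst x) `` {u})"
    thus "w \<in> adj (fst y) `` {f u}"
      using is_rooted_iso_adj[OF f u] multigraph_adjD[OF x] by auto
  qed
qed

lemma degree_iso:
  assumes f: "is_rooted_iso f x y" and x: "multigraph (fst x)" and y: "multigraph (fst y)"
    and u: "u \<in> verts (fst x)"
  shows "degree (fst y) (f u) = degree (fst x) u"
proof -
  have m: "\<And>v. v \<in> verts (fst x) \<Longrightarrow> mult (fst y) (f u) (f v) = mult (fst x) u v"
    and inj: "inj_on f (verts (fst x))"
    using f u by (auto simp: is_rooted_iso_def bij_betw_def)
  have sub: "adj (fst x) `` {u} \<subseteq> verts (fst x)" using multigraph_adjD[OF x] by blast
  have "(\<Sum>v\<in>adj (fst y) `` {f u}. mult (fst y) (f u) v) =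
      (\<Sum>v\<in>adj (fst x) `` {u}. mult (fst y) (f u) (f v))"
    unfolding adj_image[OF assms] using inj_on_subset[OF inj sub] by (simp add: sum.reindex)
  also have "\<dots> = (\<Sum>v\<in>adj (fst x) `` {u}. mult (fst x) u v)"
    using m sub by (intro sum.cong) auto
  finally show ?thesis unfolding degree_def using m[OF u] by simp
qed

lemma offspring_iso:
  assumes f: "is_rooted_iso f x y" and x: "rooted_graph x" and y: "rooted_graph y"
    and u: "u \<in> verts (fst x)"
  shows "offspring y (f u) = f ` offspring x u"
proof -
  note xg = rooted_graphD[OF x] and yg = rooted_graphD[OF y]
  have ro: "f (snd x) = snd y" using f by (simp add: is_rooted_iso_def)
  have d: "gdist (fst y) (snd y) (f v) = gdist (fst x) (snd x) v" if "v \<in> verts (fst x)" for v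
    using is_rooted_iso_gdist[OF f xg(1) yg(1) xg(4) xg(4) that] ro by simp
  have "offspring y (f u) =
      {w \<in> adj (fst y) `` {f u}. gdist (fst y) (snd y) w = gdist (fst y) (snd y) (f u) + 1}"
    by (auto simp: offspring_def)
  also have "\<dots> = f ` {w \<in> adj (fst x) `` {u}. gdist (fst x) (snd x) w = gdist (fst x) (snd x) u + 1}"
    unfolding adj_image[OF f xg(1) yg(1) u] using d u multigraph_adjD[OF xg(1)] by auto
  also have "\<dots> = f ` offspring x u" by (auto simp: offspring_def)
  finally show ?thesis .
qed

lemma tree_iso:
  assumes f: "is_rooted_iso f x y" and x: "rooted_graph x" and y: "rooted_graph y"
    and t: "tree (fst y)"
  shows "tree (fst x)"
proof -
  note xg = rooted_graphD[OF x]
  have m: "\<And>u v. u \<in> verts (fst x) \<Longrightarrow> v \<in> verts (fst x) \<Longrightarrow>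
      mult (fst y) (f u) (f v) = mult (fst x) u v"
    and inj: "inj_on f (verts (fst x))"
    using f by (auto simp: is_rooted_iso_def bij_betw_def)
  have z: "mult (fst x) u v = 0" if "\<not> (u \<in> verts (fst x) \<and> v \<in> verts (fst x))" for u v
    using xg(1) that unfolding multigraph_def by (metis gr0I)
  have l: "loopless (fst y)" and o: "\<And>u v. mult (fst y) u v \<le> 1"
    using t by (auto simp: tree_def simple_graph_def)
  have "mult (fst x) u u = 0" for u
    using l m[of u u] z[of u u] by (cases "u \<in> verts (fst x)") (auto simp: loopless_def)
  moreover have "mult (fst x) u v \<le> 1" for u v
    using o[of "f u" "f v"] m[of u v] z[of u v]
    by (cases "u \<in> verts (fst x) \<and> v \<in> verts (fst x)") auto
  moreover have "\<not> has_cycle (fst x)"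
  proof
    assume "has_cycle (fst x)"
    then obtain c where c: "3 \<le> length c" "distinct c"
        "\<And>i. i < length c \<Longrightarrow> (c ! i, c ! (Suc i mod length c)) \<in> adj (fst x)"
      unfolding has_cycle_def by blast
    have cV: "set c \<subseteq> verts (fst x)"
      using c(3) multigraph_adjD(1)[OF xg(1)] by (metis in_set_conv_nth subsetI)
    have "has_cycle (fst y)"
      unfolding has_cycle_def
    proof (intro exI[of _ "map f c"] conjI allI impI)
      show "3 \<le> length (map f c)" using c by simp
      show "distinct (map f c)" using c inj_on_subset[OF inj cV] by (simp add: distinct_map)
      fix i assume i: "i < length (map f c)"
      hence "Suc i mod length c < length c" by (intro mod_less_divisor) auto
      thus "(map f c ! i, map f c ! (Suc i mod length (map f c))) \<in> adj (fst y)"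
        using c(3)[of i] i is_rooted_iso_adj[OF f] multigraph_adjD[OF xg(1) c(3)[of i]] by simp
    qed
    thus False using t by (simp add: tree_def)
  qed
  ultimately show ?thesis using xg(3) by (simp add: tree_def simple_graph_def loopless_def)
qed


subsection \<open>The space of rooted graphs up to isomorphism\<close>

quotient_type rgraph =
  rooted / partial: "\<lambda>x y. rooted_graph x \<and> rooted_graph y \<and> rooted_iso x y"
  morphisms rep_rgraph abs_rgraph
proof (rule part_equivpI)
  have "rooted_graph (\<lparr>verts = {0}, mult = (\<lambda>_ _. 0)\<rparr>, 0)"
    by (simp add: rooted_graph_def multigraph_def locally_finite_def connected_graph_def adj_def)
  thus "\<exists>x. rooted_graph x \<and> rooted_graph x \<and> rooted_iso x x"
    using rooted_iso_refl by blast
  show "symp (\<lambda>x y. rooted_graph x \<and> rooted_graph y \<and> rooted_iso x y)"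
    by (auto intro!: sympI rooted_iso_sym dest: rooted_graphD)
  show "transp (\<lambda>x y. rooted_graph x \<and> rooted_graph y \<and> rooted_iso x y)"
    by (auto intro!: transpI intro: rooted_iso_trans)
qed

lift_definition root_degree :: "rgraph \<Rightarrow> nat" is "\<lambda>x. degree (fst x) (snd x)"
proof -
  fix x y :: rooted
  assume a: "rooted_graph x \<and> rooted_graph y \<and> rooted_iso x y"
  then obtain f where f: "is_rooted_iso f x y" by (auto simp: rooted_iso_def)
  with degree_iso[OF f, of "snd x"] a show "degree (fst x) (snd x) = degree (fst y) (snd y)"
    by (simp add: rooted_graph_def is_rooted_iso_def)
qed

lift_definition is_tree :: "rgraph \<Rightarrow> bool" is "\<lambda>x. tree (fst x)"
  unfolding rooted_iso_def using tree_iso is_rooted_iso_inv by (meson rooted_graphD(4))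

lift_definition all_have_offspring :: "rgraph \<Rightarrow> bool" is
  "\<lambda>x. \<forall>v\<in>verts (fst x). offspring x v \<noteq> {}"
proof -
  fix x y :: rooted
  assume a: "rooted_graph x \<and> rooted_graph y \<and> rooted_iso x y"
  then obtain f where f: "is_rooted_iso f x y" by (auto simp: rooted_iso_def)
  have "verts (fst y) = f ` verts (fst x)" using f by (auto simp: is_rooted_iso_def bij_betw_def)
  thus "(\<forall>v\<in>verts (fst x). offspring x v \<noteq> {}) = (\<forall>v\<in>verts (fst y). offspring y v \<noteq> {})"
    using offspring_iso[OF f] a by simp
qed

lift_definition is_infinite :: "rgraph \<Rightarrow> bool" is "\<lambda>x. infinite (verts (fst x))"
  using bij_betw_finite by (fastforce simp: rooted_iso_def is_rooted_iso_def)

lift_definition nontrivial :: "rgraph \<Rightarrow> bool" is "\<lambda>x. \<exists>v\<in>verts (fst x). v \<noteq> snd x"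
proof -
  fix x y :: rooted
  assume a: "rooted_graph x \<and> rooted_graph y \<and> rooted_iso x y"
  then obtain f where f: "bij_betw f (verts (fst x)) (verts (fst y))" "f (snd x) = snd y"
    by (auto simp: rooted_iso_def is_rooted_iso_def)
  have "f v = snd y \<longleftrightarrow> v = snd x" if "v \<in> verts (fst x)" for v
    using f that a by (metis bij_betw_inv_into_left rooted_graphD(4))
  moreover have "verts (fst y) = f ` verts (fst x)" using f by (auto simp: bij_betw_def)
  ultimately show "(\<exists>v\<in>verts (fst x). v \<noteq> snd x) = (\<exists>v\<in>verts (fst y). v \<noteq> snd y)" by auto
qed

definition agree_radii :: "rooted \<Rightarrow> rooted \<Rightarrow> nat set" where
  "agree_radii x y = {r. rooted_iso (rooted_ball r x) (rooted_ball r y)}"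

lemma rooted_dist_alt:
  "rooted_dist x y = enn2real (inverse (1 + (SUP r\<in>agree_radii x y. of_nat r)))"
  by (simp add: rooted_dist_def agree_radii_def)

lemma agree_radii_down:
  assumes "rooted_graph x" "rooted_graph y" "r \<in> agree_radii x y" "s \<le> r"
  shows "s \<in> agree_radii x y"
  using assms rooted_iso_ball_mono by (auto simp: agree_radii_def)

lemma agree_radii_sym:
  assumes "rooted_graph x" "rooted_graph y"
  shows "agree_radii x y = agree_radii y x"
  using assms by (auto simp: agree_radii_def intro!: rooted_iso_sym root_in_ball dest: rooted_graphD)

lemma ennreal_inverse_antimono: "x \<le> y \<Longrightarrow> inverse y \<le> inverse (x :: ennreal)"
  including ennreal.lifting by transfer (rule ereal_inverse_antimono)

lemma rooted_dist_antimono: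
  assumes "agree_radii x y \<subseteq> agree_radii x' y'"
  shows "rooted_dist x' y' \<le> rooted_dist x y"
proof -
  let ?s = "\<lambda>A. (SUP r\<in>A. of_nat r) :: ennreal"
  have "inverse (1 + ?s (agree_radii x' y')) \<le> inverse (1 + ?s (agree_radii x y))"
    using SUP_subset_mono[OF assms, of of_nat of_nat]
    by (intro ennreal_inverse_antimono) (simp add: add_left_mono)
  moreover have "inverse (1 + ?s (agree_radii x y)) \<le> inverse 1"
    by (intro ennreal_inverse_antimono) simp
  hence "inverse (1 + ?s (agree_radii x y)) < top"
    by (rule le_less_trans) simp
  ultimately show ?thesis unfolding rooted_dist_alt by (rule enn2real_mono)
qed

lemma rooted_dist_0_iff:
  assumes x: "rooted_graph x" and y: "rooted_graph y"
  shows "rooted_dist x y = 0 \<longleftrightarrow> rooted_iso x y"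
proof
  let ?s = "(SUP r\<in>agree_radii x y. of_nat r) :: ennreal"
  assume "rooted_dist x y = 0"
  moreover have "inverse (1 + ?s) \<le> inverse 1"
    by (intro ennreal_inverse_antimono) simp
  hence "inverse (1 + ?s) \<noteq> top" by (metis ennreal_inverse_1 ennreal_one_neq_top top.extremum_unique)
  ultimately have "inverse (1 + ?s) = 0"
    unfolding rooted_dist_alt by (simp add: enn2real_eq_0_iff)
  hence top: "?s = top" by (simp add: ennreal_inverse_eq_0_iff)
  have "r \<in> agree_radii x y" for r
  proof (rule ccontr)
    assume r: "r \<notin> agree_radii x y"
    have "?s \<le> of_nat r"
    proof (rule SUP_least)
      fix s assume "s \<in> agree_radii x y"
      hence "s \<le> r" using agree_radii_down[OF x y] r by (meson linear)
      thus "(of_nat s :: ennreal) \<le> of_nat r" by simp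
    qed
    thus False using top by (simp add: top_unique)
  qed
  thus "rooted_iso x y" using rooted_iso_if_balls[OF x y] by (simp add: agree_radii_def)
next
  assume "rooted_iso x y"
  hence "agree_radii x y = UNIV" using rooted_iso_ball[OF _ x y] by (auto simp: agree_radii_def)
  thus "rooted_dist x y = 0" unfolding rooted_dist_alt by (simp add: ennreal_SUP_of_nat_eq_top)
qed

lemma rooted_dist_triangle:
  assumes "rooted_graph x" "rooted_graph y" "rooted_graph z"
  shows "rooted_dist x z \<le> rooted_dist x y + rooted_dist y z"
proof -
  have inter: "agree_radii x y \<inter> agree_radii y z \<subseteq> agree_radii x z"
    by (auto simp: agree_radii_def intro: rooted_iso_trans)
  have "agree_radii x y \<subseteq> agree_radii y z \<or> agree_radii y z \<subseteq> agree_radii x y"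
    using agree_radii_down assms by (meson linear subsetI)
  hence "agree_radii x y \<subseteq> agree_radii x z \<or> agree_radii y z \<subseteq> agree_radii x z"
    using inter by blast
  hence "rooted_dist x z \<le> rooted_dist x y \<or> rooted_dist x z \<le> rooted_dist y z"
    using rooted_dist_antimono by blast
  moreover have "0 \<le> rooted_dist x y" "0 \<le> rooted_dist y z"
    by (simp_all add: rooted_dist_def)
  ultimately show ?thesis by linarith
qed

lemma rooted_dist_sym: "rooted_graph x \<Longrightarrow> rooted_graph y \<Longrightarrow> rooted_dist x y = rooted_dist y x"
  by (simp add: rooted_dist_alt agree_radii_sym)

instantiation rgraph :: metric_space
begin

lift_definition dist_rgraph :: "rgraph \<Rightarrow> rgraph \<Rightarrow> real" is rooted_dist
proof -
  fix x x' y y' :: rooted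
  assume a: "rooted_graph x \<and> rooted_graph x' \<and> rooted_iso x x'"
    "rooted_graph y \<and> rooted_graph y' \<and> rooted_iso y y'"
  hence z: "rooted_dist x x' = 0" "rooted_dist y y' = 0" by (simp_all add: rooted_dist_0_iff)
  have "rooted_dist x y \<le> rooted_dist x x' + (rooted_dist x' y' + rooted_dist y' y)"
    using a rooted_dist_triangle by (meson add_left_mono order_trans)
  moreover have "rooted_dist x' y' \<le> rooted_dist x' x + (rooted_dist x y + rooted_dist y y')"
    using a rooted_dist_triangle by (meson add_left_mono order_trans)
  ultimately show "rooted_dist x y = rooted_dist x' y'"
    using z a rooted_dist_sym[of x x'] rooted_dist_sym[of y y'] by simp
qed

definition uniformity_rgraph :: "(rgraph \<times> rgraph) filter" where
  "uniformity_rgraph = (INF e\<in>{0<..}. principal {(x, y). dist x y < e})"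

definition open_rgraph :: "rgraph set \<Rightarrow> bool" where
  "open_rgraph U = (\<forall>x\<in>U. eventually (\<lambda>(x', y). x' = x \<longrightarrow> y \<in> U) uniformity)"

instance
proof
  fix x y z :: rgraph
  show "dist x y = 0 \<longleftrightarrow> x = y" by transfer (simp add: rooted_dist_0_iff)
  show "dist x y \<le> dist x z + dist y z"
    by transfer (metis rooted_dist_sym rooted_dist_triangle)
qed (simp_all add: uniformity_rgraph_def open_rgraph_def)

end


section \<open>Convergence of random objects\<close>

definition conv_in_prob :: "(nat \<Rightarrow> 'a measure) \<Rightarrow> (nat \<Rightarrow> 'a \<Rightarrow> real) \<Rightarrow> real \<Rightarrow> bool" where
  "conv_in_prob P X c \<longleftrightarrow>
     (\<forall>\<epsilon>>0. (\<lambda>n. measure (P n) {\<omega> \<in> space (P n). \<epsilon> < \<bar>X n \<omega> - c\<bar>}) \<longlonglongrightarrow> 0)"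

definition weak_conv_in_prob ::
  "(nat \<Rightarrow> 'a measure) \<Rightarrow> (nat \<Rightarrow> 'a \<Rightarrow> real measure) \<Rightarrow> real measure \<Rightarrow> bool" where
  "weak_conv_in_prob P \<nu> \<mu> \<longleftrightarrow>
     (\<forall>f :: real \<Rightarrow> real. continuous_on UNIV f \<and> bounded (range f) \<longrightarrow>
        conv_in_prob P (\<lambda>n \<omega>. \<integral>x. f x \<partial>\<nu> n \<omega>) (\<integral>x. f x \<partial>\<mu>))"

definition component :: "mgraph \<Rightarrow> nat \<Rightarrow> rgraph" where
  "component G i = abs_rgraph (induced G {v. (i, v) \<in> (adj G)\<^sup>*}, i)"

definition local_conv_in_prob ::
  "(nat \<Rightarrow> 'a measure) \<Rightarrow> (nat \<Rightarrow> 'a \<Rightarrow> mgraph) \<Rightarrow> rgraph measure \<Rightarrow> bool" where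
  "local_conv_in_prob P G \<Lambda> \<longleftrightarrow>
     (\<forall>h :: rgraph \<Rightarrow> real. continuous_on UNIV h \<and> bounded (range h) \<longrightarrow>
        conv_in_prob P (\<lambda>n \<omega>. (\<Sum>i\<in>{1..n}. h (component (G n \<omega>) i)) / real n) (\<integral>x. h x \<partial>\<Lambda>))"


section \<open>The two explorations\<close>

datatype exploration = Nonbacktracking | Backtracking

fun min_size :: "exploration \<Rightarrow> nat" where
  "min_size Nonbacktracking = 3"
| "min_size Backtracking = 2"

fun admissible :: "exploration \<Rightarrow> nat \<Rightarrow> mgraph \<Rightarrow> bool" where
  "admissible Nonbacktracking n G \<longleftrightarrow>
     multigraph G \<and> verts G = {1..n} \<and> simple_graph G \<and> (\<forall>i\<in>{1..n}. 2 \<le> degree G i)"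
| "admissible Backtracking n G \<longleftrightarrow>
     multigraph G \<and> verts G = {1..n} \<and> loopless G \<and> (\<forall>i\<in>{1..n}. adj G `` {i} \<noteq> {})"

text \<open>Paths \<open>(i\<^sub>0, \<dots>, i\<^sub>k)\<close> are the extensional functions \<open>p\<close> on \<open>{0..k}\<close>.\<close>

definition nb_paths :: "nat \<Rightarrow> mgraph \<Rightarrow> nat \<Rightarrow> nat \<Rightarrow> nat \<Rightarrow> (nat \<Rightarrow> nat) set" where
  "nb_paths n G k i j =
     {p \<in> {0..k} \<rightarrow>\<^sub>E {1..n}. p 0 = i \<and> p k = j \<and>
        (\<forall>l<k. (p l, p (Suc l)) \<in> adj G) \<and>
        (\<forall>l\<in>{1..<k}. p (l - 1) \<noteq> p (l + 1))}"

text \<open>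
  The path formula is meant for \<open>k \<ge> 1\<close>; the walk at time \<open>0\<close> is at its starting point.
\<close>

definition nb_prob :: "nat \<Rightarrow> mgraph \<Rightarrow> nat \<Rightarrow> nat \<Rightarrow> nat \<Rightarrow> real" where
  "nb_prob n G k i j =
     (if k = 0 then (if i = j then 1 else 0)
      else \<Sum>p\<in>nb_paths n G k i j.
        inverse (real (degree G i) * (\<Prod>l\<in>{1..<k}. real (degree G (p l)) - 1)))"

definition bt_trans :: "mgraph \<Rightarrow> nat \<Rightarrow> nat \<Rightarrow> real" where
  "bt_trans G i j = real (mult G i j) / real (degree G i)"

text \<open>Powers of the \<open>n \<times> n\<close> transition matrix.\<close>

primrec bt_prob :: "nat \<Rightarrow> mgraph \<Rightarrow> nat \<Rightarrow> nat \<Rightarrow> nat \<Rightarrow> real" where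
  "bt_prob n G 0 i j = (if i = j then 1 else 0)"
| "bt_prob n G (Suc k) i j =
     (\<Sum>l\<in>{1..n}. bt_prob n G k i l * bt_trans G l j)"

fun step_prob :: "exploration \<Rightarrow> nat \<Rightarrow> mgraph \<Rightarrow> nat \<Rightarrow> nat \<Rightarrow> nat \<Rightarrow> real" where
  "step_prob Nonbacktracking = nb_prob"
| "step_prob Backtracking = bt_prob"

definition friendship_bias :: "exploration \<Rightarrow> nat \<Rightarrow> mgraph \<Rightarrow> nat \<Rightarrow> nat \<Rightarrow> real" where
  "friendship_bias E n G k i =
     (\<Sum>j\<in>{1..n}. step_prob E n G k i j * real (degree G j)) - real (degree G i)"

text \<open>The empirical measure: the image of the uniform probability on \<open>{1..n}\<close>.\<close>

definition bias_measure :: "exploration \<Rightarrow> nat \<Rightarrow> mgraph \<Rightarrow> nat \<Rightarrow> real measure" where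
  "bias_measure E n G k = distr (uniform_count_measure {1..n}) borel (friendship_bias E n G k)"

definition stationary :: "nat \<Rightarrow> mgraph \<Rightarrow> nat \<Rightarrow> real" where
  "stationary n G j = real (degree G j) / (\<Sum>l\<in>{1..n}. real (degree G l))"

definition tv_dist :: "nat \<Rightarrow> (nat \<Rightarrow> real) \<Rightarrow> (nat \<Rightarrow> real) \<Rightarrow> real" where
  "tv_dist n p q = (MAX A\<in>Pow {1..n}. \<bar>(\<Sum>j\<in>A. p j) - (\<Sum>j\<in>A. q j)\<bar>)"

definition worst_tv :: "exploration \<Rightarrow> nat \<Rightarrow> mgraph \<Rightarrow> nat \<Rightarrow> real" where
  "worst_tv E n G k = (MAX i\<in>{1..n}. tv_dist n (step_prob E n G k i) (stationary n G))"

definition mixing_time_scale ::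
  "exploration \<Rightarrow> (nat \<Rightarrow> 'a measure) \<Rightarrow> (nat \<Rightarrow> 'a \<Rightarrow> mgraph) \<Rightarrow> (nat \<Rightarrow> real) \<Rightarrow> bool" where
  "mixing_time_scale E P G \<psi> \<longleftrightarrow>
     filterlim \<psi> at_top sequentially \<and>
     (\<forall>k :: nat \<Rightarrow> nat. (\<lambda>n. real (k n) / \<psi> n) \<longlonglongrightarrow> 0 \<longrightarrow>
        conv_in_prob P (\<lambda>n \<omega>. worst_tv E n (G n \<omega>) (k n)) 1) \<and>
     (\<forall>k :: nat \<Rightarrow> nat. filterlim (\<lambda>n. real (k n) / \<psi> n) at_top sequentially \<longrightarrow>
        conv_in_prob P (\<lambda>n \<omega>. worst_tv E n (G n \<omega>) (k n)) 0)"

text \<open>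
  A random graph on \<open>[n]\<close> takes values in a countable set, so all functionals of it used here are
  measurable as soon as its edge multiplicities are.
\<close>

definition random_graph :: "exploration \<Rightarrow> nat \<Rightarrow> 'a measure \<Rightarrow> ('a \<Rightarrow> mgraph) \<Rightarrow> bool" where
  "random_graph E n M G \<longleftrightarrow>
     prob_space M \<and>
     (\<forall>\<omega>\<in>space M. admissible E n (G \<omega>)) \<and>
     (\<forall>i\<in>{1..n}. \<forall>j\<in>{1..n}. (\<lambda>\<omega>. mult (G \<omega>) i j) \<in> M \<rightarrow>\<^sub>M count_space UNIV)"

fun limit_tree :: "exploration \<Rightarrow> rgraph \<Rightarrow> bool" where
  "limit_tree Nonbacktracking x \<longleftrightarrow> is_tree x \<and> is_infinite x \<and> all_have_offspring x"
| "limit_tree Backtracking x \<longleftrightarrow> is_tree x \<and> nontrivial x"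

definition limit_law :: "exploration \<Rightarrow> rgraph measure \<Rightarrow> bool" where
  "limit_law E \<Lambda> \<longleftrightarrow> prob_space \<Lambda> \<and> sets \<Lambda> = sets borel \<and> (AE x in \<Lambda>. limit_tree E x)"

definition limit_bias_law :: "rgraph measure \<Rightarrow> real measure" where
  "limit_bias_law \<Lambda> =
     (let m1 = (\<integral>x. real (root_degree x) \<partial>\<Lambda>);
          m2 = (\<integral>x. (real (root_degree x))\<^sup>2 \<partial>\<Lambda>)
      in distr \<Lambda> borel (\<lambda>x. m2 / m1 - real (root_degree x)))"

end

theory Submission
  imports Defs
begin

text \<open>
  Once the walk has mixed, the vertex it sits at after \<open>k\<close> steps is nearly distributed as the
  degree-biased law \<open>\<pi>\<close>, whatever the start.  The mean degree under \<open>\<pi>\<close> is the ratio of the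
  second to the first empirical moment of the degrees, so for degrees at most \<open>D\<close> the bias at \<open>i\<close>
  is that ratio minus \<open>d\<^sub>i\<close>, up to an error of at most \<open>2 D\<close> times the total variation
  distance, simultaneously for all \<open>i\<close> (lemma \<open>friendship_bias_near_equilibrium\<close>).  The type of
  exploration enters only through this distance.

  Local convergence controls the rest.  The degree of the root is read off from the ball of radius
  one, so every function of the root degree is continuous for the local metric.  The uniform bound
  on the degrees makes truncation harmless, and therefore averages over the vertices of arbitrary
  functions of the degree converge to the corresponding expectations in the limit tree (lemma
  \<open>whp_degree_average\<close>).  Applied to \<open>d\<close> and \<open>d\<^sup>2\<close> this turns the ratio of empirical moments into
  \<open>c = m\<^sub>2 / m\<^sub>1\<close>, and applied to \<open>f (c - d)\<close> for a test function \<open>f\<close> it gives the integral of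
  \<open>f\<close> against the limit law.  Replacing \<open>c - d\<^sub>i\<close> by the actual bias costs little, because \<open>f\<close>
  is uniformly continuous on the compact interval that contains all the values concerned.

  The argument is a finite intersection of events whose probability tends to one.  They are
  measurable because a graph on \<open>[n]\<close> takes only countably many values (lemma
  \<open>sets_random_graph\<close>).
\<close>

section \<open>The root degree is a local function\<close>

lemma degree_ball_root:
  assumes "rooted_graph x"
  shows "degree (fst (rooted_ball 1 x)) (snd x) = degree (fst x) (snd x)"
proof -
  have near: "gdist (fst x) (snd x) v \<le> enat 1" if "(snd x, v) \<in> adj (fst x)" for v
    unfolding gdist_le_iff using that by (intro exI[of _ 1]) auto
  have root: "gdist (fst x) (snd x) (snd x) \<le> enat 1" by (simp add: zero_enat_def)
  have nb: "adj (fst (rooted_ball 1 x)) `` {snd x} = adj (fst x) `` {snd x}"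
    using near root by (auto simp: fst_rooted_ball adj_induced)
  show ?thesis
    unfolding degree_def nb using near root
    by (auto simp: fst_rooted_ball intro!: sum.cong)
qed

text \<open>
  Distance below \<open>1\<close> already forces the balls of radius \<open>1\<close> to be isomorphic: if they are not, then
  at most the radius \<open>0\<close> is shared and the distance is \<open>1\<close>.
\<close>

lemma root_degree_eq_if_close:
  assumes "dist x y < 1"
  shows "root_degree x = root_degree y"
  using assms
proof transfer
  fix x y :: rooted
  assume "rooted_graph x \<and> rooted_graph x \<and> rooted_iso x x"
    and "rooted_graph y \<and> rooted_graph y \<and> rooted_iso y y"
    and close: "rooted_dist x y < 1"
  hence x: "rooted_graph x" and y: "rooted_graph y" by simp_all
  have "1 \<in> agree_radii x y"
  proof (rule ccontr)
    assume "1 \<notin> agree_radii x y"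
    hence "r = 0" if "r \<in> agree_radii x y" for r
      using agree_radii_down[OF x y that, of 1] by (cases r) auto
    hence "(SUP r\<in>agree_radii x y. of_nat r) \<le> (0 :: ennreal)"
      by (intro SUP_least) auto
    hence "rooted_dist x y = 1" by (simp add: rooted_dist_alt)
    thus False using close by simp
  qed
  then obtain f where f: "is_rooted_iso f (rooted_ball 1 x) (rooted_ball 1 y)"
    by (auto simp: agree_radii_def rooted_iso_def)
  have "f (snd x) = snd y" using f by (simp add: is_rooted_iso_def)
  moreover have "degree (fst (rooted_ball 1 y)) (f (snd x)) = degree (fst (rooted_ball 1 x)) (snd x)"
    by (rule degree_iso[OF f]) (use x y in \<open>auto intro!: multigraph_ball root_in_ball dest: rooted_graphD\<close>)
  ultimately show "degree (fst x) (snd x) = degree (fst y) (snd y)"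
    using degree_ball_root[OF x] degree_ball_root[OF y] by simp
qed

lemma continuous_on_root_degree:
  fixes g :: "nat \<Rightarrow> 'b::metric_space"
  shows "continuous_on UNIV (\<lambda>x. g (root_degree x))"
  unfolding continuous_on_iff
proof (intro ballI allI impI)
  fix x :: rgraph and e :: real
  assume "0 < e"
  thus "\<exists>d>0. \<forall>x'\<in>UNIV. dist x' x < d \<longrightarrow> dist (g (root_degree x')) (g (root_degree x)) < e"
    using root_degree_eq_if_close by (intro exI[of _ 1]) (metis dist_self zero_less_one)
qed

text \<open>
  Besides the equality of degrees this needs that the component is a rooted graph at all: otherwise
  its class in the quotient is meaningless.  Connectedness holds because a path that starts at the
  root never leaves the component, and it can be reversed by symmetry of the adjacency relation.
\<close>

lemma root_degree_component:
  assumes G: "multigraph G" "finite (verts G)" and i: "i \<in> verts G"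
  shows "root_degree (component G i) = degree G i"
proof -
  let ?C = "{v. (i, v) \<in> (adj G)\<^sup>*}"
  have sub: "adj G \<subseteq> verts G \<times> verts G" using multigraph_adjD[OF G(1)] by auto
  have reach: "(i, v) \<in> (adj (induced G ?C))\<^sup>*" if "(i, v) \<in> (adj G)\<^sup>*" for v
    using that
  proof induction
    case (step v w)
    hence "(v, w) \<in> adj (induced G ?C)"
      by (auto simp: adj_induced intro: rtrancl_into_rtrancl)
    thus ?case using step.IH by (meson rtrancl_into_rtrancl)
  qed simp
  have "sym (adj (induced G ?C))"
    using multigraph_induced[OF G(1), of ?C]
    unfolding sym_def adj_def multigraph_def by (metis case_prodD case_prodI mem_Collect_eq)
  hence returns: "(v, i) \<in> (adj (induced G ?C))\<^sup>*" if "(i, v) \<in> (adj G)\<^sup>*" for v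
    using reach[OF that] by (meson sym_rtrancl symD)
  have "adj (induced G ?C) `` {u} \<subseteq> verts G" for u using sub by (auto simp: adj_induced)
  hence "locally_finite (induced G ?C)"
    unfolding locally_finite_def using G(2) finite_subset by blast
  moreover have "connected_graph (induced G ?C)"
    unfolding connected_graph_def using i reach returns
    by (auto intro: rtrancl_trans[OF returns reach])
  ultimately have "rooted_graph (induced G ?C, i)"
    unfolding rooted_graph_def using multigraph_induced[OF G(1)] i by simp
  hence "root_degree (component G i) = degree (induced G ?C) i"
    unfolding component_def by (subst root_degree.abs_eq) (simp_all add: rooted_iso_refl)
  also have "adj (induced G ?C) `` {i} = adj G `` {i}" by (auto simp: adj_induced)
  hence "degree (induced G ?C) i = degree G i"
    unfolding degree_def by (auto intro!: sum.cong)
  finally show ?thesis .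
qed

section \<open>Events of high probability\<close>

text \<open>
  The exceptional set is required to lie in a measurable set of small measure.  As
  \<^const>\<open>measure\<close> vanishes on non-measurable sets, a bound on the
  probability of the exceptional set itself would be neither monotone nor stable under conjunction
  for general \<open>Q\<close>.
\<close>

definition whp :: "(nat \<Rightarrow> 'a measure) \<Rightarrow> (nat \<Rightarrow> 'a \<Rightarrow> bool) \<Rightarrow> bool" where
  "whp P Q \<longleftrightarrow>
     (\<exists>N. (\<forall>\<^sub>F n in sequentially. N n \<in> sets (P n) \<and> (\<forall>\<omega>\<in>space (P n) - N n. Q n \<omega>)) \<and>
          (\<lambda>n. measure (P n) (N n)) \<longlonglongrightarrow> 0)"

lemma whp_mono:
  assumes "whp P Q"
    and "\<forall>\<^sub>F n in sequentially. \<forall>\<omega>\<in>space (P n). Q n \<omega> \<longrightarrow> R n \<omega>"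
  shows "whp P R"
proof -
  obtain N where N: "\<forall>\<^sub>F n in sequentially. N n \<in> sets (P n) \<and> (\<forall>\<omega>\<in>space (P n) - N n. Q n \<omega>)"
      "(\<lambda>n. measure (P n) (N n)) \<longlonglongrightarrow> 0"
    using assms(1) unfolding whp_def by blast
  from N(1) assms(2)
  have "\<forall>\<^sub>F n in sequentially. N n \<in> sets (P n) \<and> (\<forall>\<omega>\<in>space (P n) - N n. R n \<omega>)"
    by eventually_elim blast
  thus ?thesis using N(2) unfolding whp_def by blast
qed

lemma whp_conj:
  assumes "whp P Q" "whp P R"
  shows "whp P (\<lambda>n \<omega>. Q n \<omega> \<and> R n \<omega>)"
proof -
  obtain N where N: "\<forall>\<^sub>F n in sequentially. N n \<in> sets (P n) \<and> (\<forall>\<omega>\<in>space (P n) - N n. Q n \<omega>)"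
      "(\<lambda>n. measure (P n) (N n)) \<longlonglongrightarrow> 0"
    using assms(1) unfolding whp_def by blast
  obtain N' where N': "\<forall>\<^sub>F n in sequentially. N' n \<in> sets (P n) \<and> (\<forall>\<omega>\<in>space (P n) - N' n. R n \<omega>)"
      "(\<lambda>n. measure (P n) (N' n)) \<longlonglongrightarrow> 0"
    using assms(2) unfolding whp_def by blast
  have "\<forall>\<^sub>F n in sequentially. norm (measure (P n) (N n \<union> N' n)) \<le>
      measure (P n) (N n) + measure (P n) (N' n)"
    using N(1) N'(1) by eventually_elim (auto intro: measure_Un_le)
  moreover have "(\<lambda>n. measure (P n) (N n) + measure (P n) (N' n)) \<longlonglongrightarrow> 0"
    using tendsto_add[OF N(2) N'(2)] by simp
  ultimately have "(\<lambda>n. measure (P n) (N n \<union> N' n)) \<longlonglongrightarrow> 0"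
    by (rule Lim_null_comparison)
  moreover have "\<forall>\<^sub>F n in sequentially. N n \<union> N' n \<in> sets (P n) \<and>
      (\<forall>\<omega>\<in>space (P n) - (N n \<union> N' n). Q n \<omega> \<and> R n \<omega>)"
    using N(1) N'(1) by eventually_elim auto
  ultimately show ?thesis unfolding whp_def by (intro exI[of _ "\<lambda>n. N n \<union> N' n"]) simp
qed

lemma whp_AE:
  assumes "\<forall>\<^sub>F n in sequentially. AE \<omega> in P n. Q n \<omega>"
  shows "whp P Q"
proof -
  have "\<exists>N. (AE \<omega> in P n. Q n \<omega>) \<longrightarrow>
      N \<in> sets (P n) \<and> (\<forall>\<omega>\<in>space (P n) - N. Q n \<omega>) \<and> measure (P n) N = 0" for n
    by (metis AE_E3 measure_eq_emeasure_eq_ennreal enn2real_0 measure_def null_setsD1 null_setsD2)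
  then obtain N where N: "\<And>n. (AE \<omega> in P n. Q n \<omega>) \<Longrightarrow>
      N n \<in> sets (P n) \<and> (\<forall>\<omega>\<in>space (P n) - N n. Q n \<omega>) \<and> measure (P n) (N n) = 0"
    by metis
  have "\<forall>\<^sub>F n in sequentially. measure (P n) (N n) = 0"
    using assms by eventually_elim (use N in blast)
  hence "(\<lambda>n. measure (P n) (N n)) \<longlonglongrightarrow> 0" by (rule tendsto_eventually)
  moreover have "\<forall>\<^sub>F n in sequentially. N n \<in> sets (P n) \<and> (\<forall>\<omega>\<in>space (P n) - N n. Q n \<omega>)"
    using assms by eventually_elim (use N in blast)
  ultimately show ?thesis unfolding whp_def by blast
qed

text \<open>
  A set of small probability cannot be the whole space.  This transfers what holds for the random
  graphs to their deterministic limit.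
\<close>

lemma whp_const:
  assumes "whp P (\<lambda>n \<omega>. A)" and "\<forall>\<^sub>F n in sequentially. prob_space (P n)"
  shows A
proof (rule ccontr)
  assume "\<not> A"
  obtain N where N: "\<forall>\<^sub>F n in sequentially. N n \<in> sets (P n) \<and> (\<forall>\<omega>\<in>space (P n) - N n. A)"
      "(\<lambda>n. measure (P n) (N n)) \<longlonglongrightarrow> 0"
    using assms(1) unfolding whp_def by blast
  have "\<forall>\<^sub>F n in sequentially. measure (P n) (N n) = 1"
    using N(1) assms(2)
  proof eventually_elim
    case (elim n)
    hence "N n = space (P n)" using \<open>\<not> A\<close> sets.sets_into_space[of "N n" "P n"] by auto
    thus ?case using elim(2) by (simp add: prob_space.prob_space)
  qed
  hence "(\<lambda>n. measure (P n) (N n)) \<longlonglongrightarrow> 1" by (rule tendsto_eventually)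
  thus False using LIMSEQ_unique[OF N(2)] by force
qed

lemma whp_if_conv_in_prob:
  assumes "conv_in_prob P X c" "0 < \<epsilon>"
    and "\<forall>\<^sub>F n in sequentially. {\<omega> \<in> space (P n). \<epsilon> < \<bar>X n \<omega> - c\<bar>} \<in> sets (P n)"
  shows "whp P (\<lambda>n \<omega>. \<bar>X n \<omega> - c\<bar> \<le> \<epsilon>)"
  unfolding whp_def
proof (intro exI[of _ "\<lambda>n. {\<omega> \<in> space (P n). \<epsilon> < \<bar>X n \<omega> - c\<bar>}"] conjI)
  show "\<forall>\<^sub>F n in sequentially. {\<omega> \<in> space (P n). \<epsilon> < \<bar>X n \<omega> - c\<bar>} \<in> sets (P n) \<and>
      (\<forall>\<omega>\<in>space (P n) - {\<omega> \<in> space (P n). \<epsilon> < \<bar>X n \<omega> - c\<bar>}. \<bar>X n \<omega> - c\<bar> \<le> \<epsilon>)"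
    using assms(3) by eventually_elim auto
qed (use assms in \<open>simp add: conv_in_prob_def\<close>)

lemma conv_in_prob_if_whp:
  assumes "\<And>\<epsilon>. 0 < \<epsilon> \<Longrightarrow> whp P (\<lambda>n \<omega>. \<bar>X n \<omega> - c\<bar> \<le> \<epsilon>)"
    and "\<forall>\<^sub>F n in sequentially. prob_space (P n)"
  shows "conv_in_prob P X c"
  unfolding conv_in_prob_def
proof (intro allI impI)
  fix \<epsilon> :: real
  assume "0 < \<epsilon>"
  then obtain N where N: "\<forall>\<^sub>F n in sequentially. N n \<in> sets (P n) \<and>
        (\<forall>\<omega>\<in>space (P n) - N n. \<bar>X n \<omega> - c\<bar> \<le> \<epsilon>)"
      "(\<lambda>n. measure (P n) (N n)) \<longlonglongrightarrow> 0"
    using assms(1) unfolding whp_def by blast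
  have "\<forall>\<^sub>F n in sequentially.
      norm (measure (P n) {\<omega> \<in> space (P n). \<epsilon> < \<bar>X n \<omega> - c\<bar>}) \<le> measure (P n) (N n)"
    using N(1) assms(2)
  proof eventually_elim
    case (elim n)
    interpret prob_space "P n" by (rule elim)
    have "{\<omega> \<in> space (P n). \<epsilon> < \<bar>X n \<omega> - c\<bar>} \<subseteq> N n"
      using elim(1) by (auto simp: not_le[symmetric])
    thus ?case using elim(1) by (simp add: finite_measure_mono)
  qed
  thus "(\<lambda>n. measure (P n) {\<omega> \<in> space (P n). \<epsilon> < \<bar>X n \<omega> - c\<bar>}) \<longlonglongrightarrow> 0"
    using N(2) by (rule Lim_null_comparison)
qed

section \<open>Admissible graphs\<close>

lemma admissibleD:
  assumes "admissible E n G"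
  shows "multigraph G" "verts G = {1..n}"
  using assms by (cases E; simp)+

lemma admissible_degree_pos:
  assumes "admissible E n G" "i \<in> {1..n}"
  shows "1 \<le> degree G i"
proof (cases E)
  case Nonbacktracking
  hence "2 \<le> degree G i" using assms by simp
  thus ?thesis by simp
next
  case Backtracking
  note G = admissibleD[OF assms(1)]
  have "adj G `` {i} \<subseteq> {1..n}" using multigraph_adjD[OF G(1)] G(2) by auto
  hence "finite (adj G `` {i})" by (rule finite_subset) simp
  moreover obtain j where "j \<in> adj G `` {i}" using assms Backtracking by (metis admissible.simps(2) ex_in_conv)
  ultimately have "0 < (\<Sum>v\<in>adj G `` {i}. mult G i v)"
    by (intro sum_pos2[of _ j]) (auto simp: adj_def)
  thus ?thesis by (simp add: degree_def)
qed

lemma admissible_eqI: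
  assumes "admissible E n G" "admissible E n H"
    and "\<And>i j. i \<in> {1..n} \<Longrightarrow> j \<in> {1..n} \<Longrightarrow> mult G i j = mult H i j"
  shows "G = H"
proof -
  note G = admissibleD[OF assms(1)] and H = admissibleD[OF assms(2)]
  have "mult G i j = mult H i j" for i j
  proof (cases "i \<in> {1..n} \<and> j \<in> {1..n}")
    case False
    hence "\<not> 0 < mult G i j" "\<not> 0 < mult H i j"
      using G H unfolding multigraph_def by blast+
    thus ?thesis by simp
  qed (use assms(3) in blast)
  thus ?thesis using G(2) H(2) by (cases G; cases H) auto
qed

text \<open>
  An admissible graph on \<open>[n]\<close> is determined by its matrix of multiplicities.  There
  are countably many such matrices, so every event about the graph is a countable union of events
  that fix all the entries.
\<close>

lemma sets_random_graph:
  assumes "random_graph E n M G"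
  shows "{\<omega> \<in> space M. Q (G \<omega>)} \<in> sets M"
proof -
  let ?I = "{1..n} \<times> {1..n}"
  define A where "A m = {\<omega> \<in> space M. \<forall>i\<in>{1..n}. \<forall>j\<in>{1..n}. mult (G \<omega>) i j = m (i, j)}" for m
  define S where "S = {m \<in> ?I \<rightarrow>\<^sub>E (UNIV :: nat set). \<exists>\<omega>\<in>A m. Q (G \<omega>)}"
  have adm: "admissible E n (G \<omega>)" if "\<omega> \<in> space M" for \<omega>
    using assms that by (simp add: random_graph_def)
  have "A m \<in> sets M" for m
  proof -
    have "{\<omega> \<in> space M. mult (G \<omega>) i j = c} \<in> sets M" if "i \<in> {1..n}" "j \<in> {1..n}" for i j c
    proof -
      have "(\<lambda>\<omega>. mult (G \<omega>) i j) \<in> M \<rightarrow>\<^sub>M count_space UNIV"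
        using assms that by (simp add: random_graph_def)
      from measurable_sets[OF this, of "{c}"] show ?thesis
        by (simp add: vimage_def Int_def conj_commute)
    qed
    thus ?thesis unfolding A_def by (intro sets.sets_Collect_finite_All) simp_all
  qed
  moreover have "countable S"
    unfolding S_def by (rule countable_subset[of _ "?I \<rightarrow>\<^sub>E UNIV"]) (auto intro!: countable_PiE)
  ultimately have "(\<Union>m\<in>S. A m) \<in> sets M" by blast
  also have "(\<Union>m\<in>S. A m) = {\<omega> \<in> space M. Q (G \<omega>)}"
  proof (intro equalityI subsetI)
    fix \<omega> assume "\<omega> \<in> (\<Union>m\<in>S. A m)"
    then obtain m \<omega>' where m: "\<omega> \<in> A m" "\<omega>' \<in> A m" "Q (G \<omega>')" by (auto simp: S_def)
    hence "G \<omega> = G \<omega>'" by (intro admissible_eqI[of E n]) (auto simp: A_def adm)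
    thus "\<omega> \<in> {\<omega> \<in> space M. Q (G \<omega>)}" using m by (simp add: A_def)
  next
    fix \<omega> assume w: "\<omega> \<in> {\<omega> \<in> space M. Q (G \<omega>)}"
    define m where "m = restrict (\<lambda>(i, j). mult (G \<omega>) i j) ?I"
    have "\<omega> \<in> A m" using w by (simp add: A_def m_def)
    moreover have "m \<in> ?I \<rightarrow>\<^sub>E UNIV" by (simp add: m_def)
    ultimately show "\<omega> \<in> (\<Union>m\<in>S. A m)" using w by (auto simp: S_def)
  qed
  finally show ?thesis .
qed

section \<open>The bias of a well-mixed walk\<close>

text \<open>
  The factor \<open>2\<close> comes from splitting \<open>\<Sum> \<bar>p - q\<bar>\<close> into the sets where \<open>p\<close> and where \<open>q\<close> is the
  larger; each of the two parts is at most the total variation distance.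
\<close>

lemma expectation_diff_le_tv_dist:
  assumes "\<And>j. j \<in> {1..n} \<Longrightarrow> 0 \<le> d j \<and> d j \<le> D" and D: "0 \<le> D"
  shows "\<bar>(\<Sum>j\<in>{1..n}. p j * d j) - (\<Sum>j\<in>{1..n}. q j * d j)\<bar> \<le> 2 * D * tv_dist n p q"
proof -
  have tv: "\<bar>\<Sum>j\<in>A. p j - q j\<bar> \<le> tv_dist n p q" if "A \<subseteq> {1..n}" for A
    unfolding tv_dist_def using that by (intro Max_ge) (auto simp: sum_subtractf)
  let ?A = "{j \<in> {1..n}. q j \<le> p j}" and ?B = "{j \<in> {1..n}. \<not> q j \<le> p j}"
  have "\<bar>\<Sum>j\<in>{1..n}. (p j - q j) * d j\<bar> \<le> (\<Sum>j\<in>{1..n}. \<bar>p j - q j\<bar> * D)"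
    using assms by (intro order_trans[OF sum_abs] sum_mono) (auto simp: abs_mult intro!: mult_left_mono)
  also have "\<dots> = D * (\<Sum>j\<in>?A \<union> ?B. \<bar>p j - q j\<bar>)"
    unfolding sum_distrib_left by (intro sum.cong) auto
  also have "(\<Sum>j\<in>?A \<union> ?B. \<bar>p j - q j\<bar>) = (\<Sum>j\<in>?A. \<bar>p j - q j\<bar>) + (\<Sum>j\<in>?B. \<bar>p j - q j\<bar>)"
    by (intro sum.union_disjoint) auto
  also have "(\<Sum>j\<in>?A. \<bar>p j - q j\<bar>) = (\<Sum>j\<in>?A. p j - q j)" by (intro sum.cong) auto
  also have "(\<Sum>j\<in>?B. \<bar>p j - q j\<bar>) = - (\<Sum>j\<in>?B. p j - q j)"
    unfolding sum_negf[symmetric] by (intro sum.cong) auto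
  also have "D * ((\<Sum>j\<in>?A. p j - q j) + - (\<Sum>j\<in>?B. p j - q j)) \<le> D * (2 * tv_dist n p q)"
  proof (rule mult_left_mono[OF _ D])
    have "\<bar>\<Sum>j\<in>?A. p j - q j\<bar> \<le> tv_dist n p q" "\<bar>\<Sum>j\<in>?B. p j - q j\<bar> \<le> tv_dist n p q"
      by (rule tv, blast)+
    thus "(\<Sum>j\<in>?A. p j - q j) + - (\<Sum>j\<in>?B. p j - q j) \<le> 2 * tv_dist n p q"
      by linarith
  qed
  finally show ?thesis by (simp add: sum_subtractf left_diff_distrib mult.assoc mult.left_commute)
qed

definition mean_deg_pow :: "nat \<Rightarrow> mgraph \<Rightarrow> nat \<Rightarrow> real" where
  "mean_deg_pow n G a = (\<Sum>i\<in>{1..n}. real (degree G i) ^ a) / real n"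

lemma stationary_mean_degree:
  "(\<Sum>j\<in>{1..n}. stationary n G j * real (degree G j)) = mean_deg_pow n G 2 / mean_deg_pow n G 1"
  by (cases "n = 0")
    (simp_all add: stationary_def mean_deg_pow_def sum_divide_distrib[symmetric] power2_eq_square)

lemma friendship_bias_near_equilibrium:
  assumes "\<And>j. j \<in> {1..n} \<Longrightarrow> real (degree G j) \<le> D" and i: "i \<in> {1..n}"
  shows "\<bar>friendship_bias E n G k i -
      (mean_deg_pow n G 2 / mean_deg_pow n G 1 - real (degree G i))\<bar> \<le> 2 * D * worst_tv E n G k"
proof -
  have D: "0 \<le> D" using assms(1)[OF i] by linarith
  have "tv_dist n (step_prob E n G k i) (stationary n G) \<le> worst_tv E n G k"
    unfolding worst_tv_def using i by (intro Max_ge) auto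
  hence "2 * D * tv_dist n (step_prob E n G k i) (stationary n G) \<le> 2 * D * worst_tv E n G k"
    using D by (intro mult_left_mono) auto
  with expectation_diff_le_tv_dist[of n "\<lambda>j. real (degree G j)" D "step_prob E n G k i" "stationary n G"]
  show ?thesis using assms(1) D
    unfolding friendship_bias_def stationary_mean_degree by simp
qed

lemma integral_bias_measure:
  fixes f :: "real \<Rightarrow> real"
  assumes "continuous_on UNIV f"
  shows "(\<integral>x. f x \<partial>bias_measure E n G k) = (\<Sum>i\<in>{1..n}. f (friendship_bias E n G k i)) / real n"
proof -
  have "f \<in> borel_measurable borel" using assms by (rule borel_measurable_continuous_onI)
  hence "(\<integral>x. f x \<partial>bias_measure E n G k) =
      (\<integral>i. f (friendship_bias E n G k i) \<partial>uniform_count_measure {1..n})"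
    unfolding bias_measure_def by (intro integral_distr) (simp_all add: measurable_def space_uniform_count_measure sets_uniform_count_measure)
  thus ?thesis by (simp add: integral_uniform_count_measure)
qed

lemma quotient_diff_le:
  fixes a b a' b' :: real
  assumes "1 \<le> a" "1 \<le> a'" "0 \<le> b"
  shows "\<bar>b' / a' - b / a\<bar> \<le> \<bar>b' - b\<bar> + b * \<bar>a' - a\<bar>"
proof -
  have "b' / a' - b / a = (b' - b) / a' + b * (a - a') / (a * a')"
    using assms by (simp add: field_simps)
  hence "\<bar>b' / a' - b / a\<bar> \<le> \<bar>(b' - b) / a'\<bar> + \<bar>b * (a - a') / (a * a')\<bar>"
    by (metis abs_triangle_ineq)
  moreover have "\<bar>(b' - b) / a'\<bar> \<le> \<bar>b' - b\<bar> / 1"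
    unfolding abs_divide using assms by (intro divide_left_mono) auto
  moreover have "1 * 1 \<le> a * a'" using assms by (intro mult_mono) auto
  hence "\<bar>b * (a - a') / (a * a')\<bar> \<le> b * \<bar>a' - a\<bar> / 1"
    unfolding abs_divide abs_mult[of b] abs_minus_commute[of a] using assms
    by (intro frac_le) auto
  ultimately show ?thesis by simp
qed

text \<open>
  The errors add up to \<open>2 D \<eta>\<close> from mixing and to \<open>\<eta> + m\<^sub>2 \<eta>\<close> from the quotient of the two
  empirical moments.  Its denominator stays away from \<open>0\<close> since all degrees are at least \<open>1\<close>.
\<close>

lemma friendship_bias_near_limit:
  assumes degs: "\<forall>i\<in>{1..n}. degree G i \<in> {1..D}" and i: "i \<in> {1..n}"
    and tv: "worst_tv E n G k \<le> \<eta>"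
    and mean1: "\<bar>mean_deg_pow n G 1 - m1\<bar> \<le> \<eta>" and mean2: "\<bar>mean_deg_pow n G 2 - m2\<bar> \<le> \<eta>"
    and m1: "1 \<le> m1" and m2: "0 \<le> m2"
  shows "\<bar>friendship_bias E n G k i - (m2 / m1 - real (degree G i))\<bar> \<le> (2 * real D + 1 + m2) * \<eta>"
proof -
  have "real n \<le> (\<Sum>i\<in>{1..n}. real (degree G i))"
    using sum_mono[of "{1..n}" "\<lambda>_. 1" "\<lambda>i. real (degree G i)"] degs by simp
  hence mean_ge: "1 \<le> mean_deg_pow n G 1" using i by (simp add: mean_deg_pow_def)
  have "\<bar>mean_deg_pow n G 2 / mean_deg_pow n G 1 - m2 / m1\<bar> \<le>
      \<bar>mean_deg_pow n G 2 - m2\<bar> + m2 * \<bar>mean_deg_pow n G 1 - m1\<bar>"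
    by (rule quotient_diff_le[OF m1 mean_ge m2])
  also have "\<dots> \<le> \<eta> + m2 * \<eta>" using mean1 mean2 m2 by (intro add_mono mult_left_mono)
  finally have ratio: "\<bar>mean_deg_pow n G 2 / mean_deg_pow n G 1 - m2 / m1\<bar> \<le> \<eta> + m2 * \<eta>" .
  have "\<bar>friendship_bias E n G k i -
      (mean_deg_pow n G 2 / mean_deg_pow n G 1 - real (degree G i))\<bar> \<le> 2 * real D * worst_tv E n G k"
    using degs by (intro friendship_bias_near_equilibrium i) auto
  also have "\<dots> \<le> 2 * real D * \<eta>" using tv by (intro mult_left_mono) auto
  finally show ?thesis using ratio by (simp add: algebra_simps)
qed

section \<open>Averages over the vertices\<close>

lemma whp_functional_near:
  assumes graphs: "\<forall>\<^sub>F n in sequentially. random_graph E n (P n) (G n)"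
    and conv: "conv_in_prob P (\<lambda>n \<omega>. F n (G n \<omega>)) c" and "0 < \<epsilon>"
  shows "whp P (\<lambda>n \<omega>. \<bar>F n (G n \<omega>) - c\<bar> \<le> \<epsilon>)"
proof (rule whp_if_conv_in_prob[OF conv \<open>0 < \<epsilon>\<close>])
  show "\<forall>\<^sub>F n in sequentially. {\<omega> \<in> space (P n). \<epsilon> < \<bar>F n (G n \<omega>) - c\<bar>} \<in> sets (P n)"
    using graphs by eventually_elim (rule sets_random_graph)
qed

context
  fixes E :: exploration and P :: "nat \<Rightarrow> 'a measure" and G :: "nat \<Rightarrow> 'a \<Rightarrow> mgraph"
    and \<Lambda> :: "rgraph measure"
  assumes graphs: "\<forall>\<^sub>F n in sequentially. random_graph E n (P n) (G n)"
    and limit: "limit_law E \<Lambda>"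
    and local_conv: "local_conv_in_prob P G \<Lambda>"
begin

lemma whp_bounded_degree_average:
  fixes g :: "nat \<Rightarrow> real"
  assumes "bounded (range g)" "0 < \<epsilon>"
  shows "whp P (\<lambda>n \<omega>. \<bar>(\<Sum>i\<in>{1..n}. g (degree (G n \<omega>) i)) / real n - (\<integral>x. g (root_degree x) \<partial>\<Lambda>)\<bar> \<le> \<epsilon>)"
proof -
  have "bounded (range (\<lambda>x. g (root_degree x)))"
    using assms(1) by (rule bounded_subset) auto
  with local_conv have "conv_in_prob P
      (\<lambda>n \<omega>. (\<Sum>i\<in>{1..n}. g (root_degree (component (G n \<omega>) i))) / real n) (\<integral>x. g (root_degree x) \<partial>\<Lambda>)"
    unfolding local_conv_in_prob_def using continuous_on_root_degree[of g] by blast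
  from whp_functional_near[OF graphs this assms(2)] show ?thesis
  proof (rule whp_mono)
    show "\<forall>\<^sub>F n in sequentially. \<forall>\<omega>\<in>space (P n).
        \<bar>(\<Sum>i\<in>{1..n}. g (root_degree (component (G n \<omega>) i))) / real n - (\<integral>x. g (root_degree x) \<partial>\<Lambda>)\<bar> \<le> \<epsilon> \<longrightarrow>
        \<bar>(\<Sum>i\<in>{1..n}. g (degree (G n \<omega>) i)) / real n - (\<integral>x. g (root_degree x) \<partial>\<Lambda>)\<bar> \<le> \<epsilon>"
      using graphs
    proof eventually_elim
      case (elim n)
      have "root_degree (component (G n \<omega>) i) = degree (G n \<omega>) i"
        if "\<omega> \<in> space (P n)" "i \<in> {1..n}" for \<omega> i
        using root_degree_component admissibleD[of E n "G n \<omega>"] elim that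
        by (simp add: random_graph_def)
      thus ?case by simp
    qed
  qed
qed

lemma borel_measurable_root_degree:
  fixes g :: "nat \<Rightarrow> real"
  shows "(\<lambda>x. g (root_degree x)) \<in> borel_measurable \<Lambda>"
proof -
  have "sets \<Lambda> = sets borel" using limit by (simp add: limit_law_def)
  thus ?thesis
    using borel_measurable_continuous_onI[OF continuous_on_root_degree[of g]]
    by (simp cong: measurable_cong_sets)
qed

text \<open>
  The indicator of the complement of \<open>S\<close> averages to \<open>0\<close> over the vertices, so its expectation
  in the limit vanishes as well.
\<close>

lemma AE_root_degree:
  assumes "whp P (\<lambda>n \<omega>. \<forall>i\<in>{1..n}. degree (G n \<omega>) i \<in> S)"
  shows "AE x in \<Lambda>. root_degree x \<in> S"
proof -
  interpret \<Lambda>: prob_space \<Lambda> using limit by (simp add: limit_law_def)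
  have spaces: "\<forall>\<^sub>F n in sequentially. prob_space (P n)"
    using graphs by eventually_elim (simp add: random_graph_def)
  define g :: "nat \<Rightarrow> real" where "g d = indicator (- S) d" for d
  have bounded: "bounded (range g)"
    by (rule boundedI[of _ 1]) (auto simp: g_def indicator_def)
  let ?I = "\<integral>x. g (root_degree x) \<partial>\<Lambda>"
  have "\<bar>?I\<bar> \<le> \<epsilon>" if "0 < \<epsilon>" for \<epsilon>
  proof (rule whp_const[OF _ spaces])
    have zero: "(\<Sum>i\<in>{1..n}. g (degree H i)) = 0" if "\<forall>i\<in>{1..n}. degree H i \<in> S" for n H
      using that by (intro sum.neutral) (simp add: g_def)
    from whp_conj[OF assms whp_bounded_degree_average[OF bounded that]]
    show "whp P (\<lambda>n \<omega>. \<bar>?I\<bar> \<le> \<epsilon>)"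
    proof (rule whp_mono, intro always_eventually allI ballI impI, elim conjE)
      fix n \<omega>
      assume S: "\<forall>i\<in>{1..n}. degree (G n \<omega>) i \<in> S"
        and "\<bar>(\<Sum>i\<in>{1..n}. g (degree (G n \<omega>) i)) / real n - ?I\<bar> \<le> \<epsilon>"
      thus "\<bar>?I\<bar> \<le> \<epsilon>" unfolding zero[OF S] by simp
    qed
  qed
  hence "?I = 0" by (metis abs_le_zero_iff field_le_epsilon add_0)
  moreover have "integrable \<Lambda> (\<lambda>x. g (root_degree x))"
    by (rule \<Lambda>.integrable_const_bound[of _ 1, OF _ borel_measurable_root_degree])
      (simp add: g_def indicator_def)
  ultimately have "AE x in \<Lambda>. g (root_degree x) = 0"
    by (subst (asm) integral_nonneg_eq_0_iff_AE) (auto simp: g_def)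
  thus ?thesis by eventually_elim (auto simp: g_def indicator_def split: if_splits)
qed

text \<open>
  Truncating \<open>g\<close> to \<open>0\<close> outside \<open>S\<close> makes it bounded and changes neither the averages nor, by
  \<open>AE_root_degree\<close>, the expectation.
\<close>

lemma whp_degree_average:
  fixes g :: "nat \<Rightarrow> real"
  assumes S: "whp P (\<lambda>n \<omega>. \<forall>i\<in>{1..n}. degree (G n \<omega>) i \<in> S)" "finite S" and "0 < \<epsilon>"
  shows "whp P (\<lambda>n \<omega>. \<bar>(\<Sum>i\<in>{1..n}. g (degree (G n \<omega>) i)) / real n - (\<integral>x. g (root_degree x) \<partial>\<Lambda>)\<bar> \<le> \<epsilon>)"
proof -
  define g' where "g' d = (if d \<in> S then g d else 0)" for d
  have "range g' \<subseteq> insert 0 (g ` S)" by (auto simp: g'_def)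
  hence bounded: "bounded (range g')"
    using S(2) by (meson finite_imageI finite_imp_bounded finite_insert bounded_subset)
  have int: "(\<integral>x. g (root_degree x) \<partial>\<Lambda>) = (\<integral>x. g' (root_degree x) \<partial>\<Lambda>)"
    using AE_root_degree[OF S(1)]
    by (intro integral_cong_AE borel_measurable_root_degree) (auto simp: g'_def)
  have sum: "(\<Sum>i\<in>{1..n}. g' (degree H i)) = (\<Sum>i\<in>{1..n}. g (degree H i))"
    if "\<forall>i\<in>{1..n}. degree H i \<in> S" for n H
    using that by (intro sum.cong) (auto simp: g'_def)
  from whp_conj[OF S(1) whp_bounded_degree_average[OF bounded \<open>0 < \<epsilon>\<close>]]
  show ?thesis
  proof (rule whp_mono, intro always_eventually allI ballI impI, elim conjE)
    fix n \<omega>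
    assume in_S: "\<forall>i\<in>{1..n}. degree (G n \<omega>) i \<in> S"
      and "\<bar>(\<Sum>i\<in>{1..n}. g' (degree (G n \<omega>) i)) / real n - (\<integral>x. g' (root_degree x) \<partial>\<Lambda>)\<bar> \<le> \<epsilon>"
    thus "\<bar>(\<Sum>i\<in>{1..n}. g (degree (G n \<omega>) i)) / real n - (\<integral>x. g (root_degree x) \<partial>\<Lambda>)\<bar> \<le> \<epsilon>"
      unfolding sum[OF in_S] int by simp
  qed
qed

end

section \<open>Convergence of the empirical bias law\<close>

theorem theorem5p2:
  fixes E :: exploration
    and P :: "nat \<Rightarrow> 'a measure"
    and G :: "nat \<Rightarrow> 'a \<Rightarrow> mgraph"
    and \<psi> :: "nat \<Rightarrow> real"
    and \<Lambda> :: "rgraph measure"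
    and k :: "nat \<Rightarrow> nat"
  assumes "\<And>n. min_size E \<le> n \<Longrightarrow> random_graph E n (P n) (G n)"
    and "mixing_time_scale E P G \<psi>"
    and "\<exists>K :: real. \<forall>n\<ge>min_size E. AE \<omega> in P n. \<forall>i\<in>{1..n}. (real (degree (G n \<omega>) i))\<^sup>2 \<le> K"
    and "limit_law E \<Lambda>"
    and "local_conv_in_prob P G \<Lambda>"
    and "filterlim (\<lambda>n. real (k n) / \<psi> n) at_top sequentially"
  shows "weak_conv_in_prob P (\<lambda>n \<omega>. bias_measure E n (G n \<omega>) (k n)) (limit_bias_law \<Lambda>)"
proof -
  have graphs: "\<forall>\<^sub>F n in sequentially. random_graph E n (P n) (G n)"
    using eventually_ge_at_top[of "min_size E"] by eventually_elim (rule assms(1))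
  hence spaces: "\<forall>\<^sub>F n in sequentially. prob_space (P n)"
    by eventually_elim (simp add: random_graph_def)
  note lim = graphs assms(4,5)
  interpret \<Lambda>: prob_space \<Lambda> using assms(4) by (simp add: limit_law_def)
  obtain K where K: "\<And>n. min_size E \<le> n \<Longrightarrow>
      AE \<omega> in P n. \<forall>i\<in>{1..n}. (real (degree (G n \<omega>) i))\<^sup>2 \<le> K"
    using assms(3) by blast
  define D where "D = nat \<lceil>sqrt K\<rceil>"
  have deg_le: "d \<le> D" if "(real d)\<^sup>2 \<le> K" for d
  proof -
    have "real d \<le> sqrt K" using that by (rule real_le_rsqrt)
    thus ?thesis unfolding D_def by linarith
  qed
  \<comment> \<open>The lower bound \<open>1\<close> keeps the first moments away from \<open>0\<close>.\<close>
  have degs: "whp P (\<lambda>n \<omega>. \<forall>i\<in>{1..n}. degree (G n \<omega>) i \<in> {1..D})"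
  proof (rule whp_AE)
    show "\<forall>\<^sub>F n in sequentially. AE \<omega> in P n. \<forall>i\<in>{1..n}. degree (G n \<omega>) i \<in> {1..D}"
      using graphs eventually_ge_at_top[of "min_size E"]
    proof eventually_elim
      case (elim n)
      from K[OF elim(2)] AE_space[of "P n"] show ?case
      proof eventually_elim
        case (elim \<omega>)
        hence "admissible E n (G n \<omega>)"
          using \<open>random_graph E n (P n) (G n)\<close> by (simp add: random_graph_def)
        thus ?case using elim(1) deg_le admissible_degree_pos[of E n "G n \<omega>"] by auto
      qed
    qed
  qed
  note average = whp_degree_average[OF lim degs finite_atLeastAtMost]
  have AE_deg: "AE x in \<Lambda>. root_degree x \<in> {1..D}" by (rule AE_root_degree[OF lim degs])
  define m1 where "m1 = (\<integral>x. real (root_degree x) \<partial>\<Lambda>)"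
  define m2 where "m2 = (\<integral>x. (real (root_degree x))\<^sup>2 \<partial>\<Lambda>)"
  have "integrable \<Lambda> (\<lambda>x. real (root_degree x))"
    by (rule \<Lambda>.integrable_const_bound[of _ "real D"])
      (use AE_deg borel_measurable_root_degree[OF lim] in auto)
  hence m1: "1 \<le> m1"
    unfolding m1_def by (rule \<Lambda>.integral_ge_const) (use AE_deg in auto)
  have m2: "0 \<le> m2" unfolding m2_def by simp
  define c where "c = m2 / m1"
  show ?thesis
    unfolding weak_conv_in_prob_def
  proof (intro allI impI, elim conjE)
    fix f :: "real \<Rightarrow> real"
    assume f: "continuous_on UNIV f" "bounded (range f)"
    have f_meas: "f \<in> borel_measurable borel" by (rule borel_measurable_continuous_onI[OF f(1)])
    have lim_int: "(\<integral>x. f x \<partial>limit_bias_law \<Lambda>) = (\<integral>x. f (c - real (root_degree x)) \<partial>\<Lambda>)"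
      unfolding limit_bias_law_def Let_def c_def m1_def m2_def
      using f_meas borel_measurable_root_degree[OF lim, of "\<lambda>d. _ - real d"]
      by (intro integral_distr) auto
    show "conv_in_prob P (\<lambda>n \<omega>. \<integral>x. f x \<partial>bias_measure E n (G n \<omega>) (k n)) (\<integral>x. f x \<partial>limit_bias_law \<Lambda>)"
      unfolding integral_bias_measure[OF f(1)] lim_int
    proof (rule conv_in_prob_if_whp[OF _ spaces])
      fix \<epsilon> :: real
      assume "0 < \<epsilon>"
      \<comment> \<open>Room \<open>1\<close> beyond \<open>D\<close> holds the biases, which turn out to be within \<open>\<delta> < 1\<close> of \<open>c - d\<^sub>i\<close>.\<close>
      let ?K = "cball c (real D + 1)"
      have "uniformly_continuous_on ?K f"
        by (intro compact_uniformly_continuous continuous_on_subset[OF f(1)]) auto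
      then obtain \<delta>' where d': "0 < \<delta>'"
          "\<And>x y. x \<in> ?K \<Longrightarrow> y \<in> ?K \<Longrightarrow> dist y x < \<delta>' \<Longrightarrow> dist (f y) (f x) < \<epsilon> / 2"
        unfolding uniformly_continuous_on_def using \<open>0 < \<epsilon>\<close> by (metis half_gt_zero)
      define \<delta> where "\<delta> = min 1 \<delta>' / 2"
      have \<delta>: "0 < \<delta>" "\<delta> < 1" "\<delta> < \<delta>'" using d'(1) by (auto simp: \<delta>_def)
      have pos: "0 < 2 * real D + 1 + m2" using m2 by linarith
      define \<eta> where "\<eta> = \<delta> / (2 * real D + 1 + m2)"
      have \<eta>: "0 < \<eta>" "(2 * real D + 1 + m2) * \<eta> = \<delta>"
        using pos \<delta>(1) by (simp_all add: \<eta>_def)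
      have tv: "whp P (\<lambda>n \<omega>. \<bar>worst_tv E n (G n \<omega>) (k n) - 0\<bar> \<le> \<eta>)"
        using assms(2,6) \<eta>(1) unfolding mixing_time_scale_def
        by (intro whp_functional_near[OF graphs]) auto
      have mean1: "whp P (\<lambda>n \<omega>. \<bar>mean_deg_pow n (G n \<omega>) 1 - m1\<bar> \<le> \<eta>)"
        using average[OF \<eta>(1), of real] by (simp add: mean_deg_pow_def m1_def)
      have mean2: "whp P (\<lambda>n \<omega>. \<bar>mean_deg_pow n (G n \<omega>) 2 - m2\<bar> \<le> \<eta>)"
        using average[OF \<eta>(1), of "\<lambda>d. (real d)\<^sup>2"] by (simp add: mean_deg_pow_def m2_def)
      have f_avg: "whp P (\<lambda>n \<omega>. \<bar>(\<Sum>i\<in>{1..n}. f (c - real (degree (G n \<omega>) i))) / real n -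
          (\<integral>x. f (c - real (root_degree x)) \<partial>\<Lambda>)\<bar> \<le> \<epsilon> / 2)"
        using average[of "\<epsilon> / 2" "\<lambda>d. f (c - real d)"] \<open>0 < \<epsilon>\<close> by simp
      have close: "\<bar>(\<Sum>i\<in>{1..n}. f (friendship_bias E n H k i)) / real n -
          (\<Sum>i\<in>{1..n}. f (c - real (degree H i))) / real n\<bar> \<le> \<epsilon> / 2"
        if H: "\<forall>i\<in>{1..n}. degree H i \<in> {1..D}" "\<bar>worst_tv E n H k - 0\<bar> \<le> \<eta>"
          "\<bar>mean_deg_pow n H 1 - m1\<bar> \<le> \<eta>" "\<bar>mean_deg_pow n H 2 - m2\<bar> \<le> \<eta>" and n: "0 < n"
        for n H k
      proof -
        have each: "\<bar>f (friendship_bias E n H k i) - f (c - real (degree H i))\<bar> \<le> \<epsilon> / 2"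
          if i: "i \<in> {1..n}" for i
        proof -
          have near: "\<bar>friendship_bias E n H k i - (c - real (degree H i))\<bar> \<le> \<delta>"
            using friendship_bias_near_limit[OF H(1) i _ H(3,4) m1 m2, of E k] H(2)
            unfolding c_def \<eta>(2) by simp
          have "degree H i \<le> D" using H(1) i by auto
          hence "c - real (degree H i) \<in> ?K" "friendship_bias E n H k i \<in> ?K"
            using near \<delta>(2) by (simp_all add: dist_real_def)
          from d'(2)[OF this] near \<delta>(3) show ?thesis by (simp add: dist_real_def)
        qed
        have "\<bar>(\<Sum>i\<in>{1..n}. f (friendship_bias E n H k i)) - (\<Sum>i\<in>{1..n}. f (c - real (degree H i)))\<bar> \<le>
            (\<Sum>i\<in>{1..n}. \<epsilon> / 2)"
          unfolding sum_subtractf[symmetric]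
          by (rule order_trans[OF sum_abs]) (intro sum_mono each)
        thus ?thesis
          using n unfolding diff_divide_distrib[symmetric] abs_divide
          by (simp add: field_simps)
      qed
      from whp_conj[OF degs whp_conj[OF tv whp_conj[OF mean1 whp_conj[OF mean2 f_avg]]]]
      show "whp P (\<lambda>n \<omega>. \<bar>(\<Sum>i\<in>{1..n}. f (friendship_bias E n (G n \<omega>) (k n) i)) / real n -
          (\<integral>x. f (c - real (root_degree x)) \<partial>\<Lambda>)\<bar> \<le> \<epsilon>)"
      proof (rule whp_mono, goal_cases)
        case 1
        show ?case
          using eventually_gt_at_top[of 0]
        proof eventually_elim
          case (elim n)
          show ?case
          proof (intro ballI impI, elim conjE)
            fix \<omega>
            assume "\<forall>i\<in>{1..n}. degree (G n \<omega>) i \<in> {1..D}"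
              "\<bar>worst_tv E n (G n \<omega>) (k n) - 0\<bar> \<le> \<eta>"
              "\<bar>mean_deg_pow n (G n \<omega>) 1 - m1\<bar> \<le> \<eta>" "\<bar>mean_deg_pow n (G n \<omega>) 2 - m2\<bar> \<le> \<eta>"
              and avg: "\<bar>(\<Sum>i\<in>{1..n}. f (c - real (degree (G n \<omega>) i))) / real n -
                (\<integral>x. f (c - real (root_degree x)) \<partial>\<Lambda>)\<bar> \<le> \<epsilon> / 2"
            from close[OF this(1-4) elim] avg
            show "\<bar>(\<Sum>i\<in>{1..n}. f (friendship_bias E n (G n \<omega>) (k n) i)) / real n -
                (\<integral>x. f (c - real (root_degree x)) \<partial>\<Lambda>)\<bar> \<le> \<epsilon>" by linarith
          qed
        qed
      qed
    qed
  qed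
qed

end
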